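(* Let $E$ be any directed graph, $K$ any field and $c$ an exclusive cycle in $E$. Letting $u\in E^0$, $e\in E^1$ and $e^*$ act by the $K$-linear operators $P_u$, $S_e$, $S_{e^*}$ respectively, the $K$-vector space $K[[F^+_E(c^0)[\mathbb N]]]$ is a left $L_K(E)$-premodule, while its subspace $K[[F^+_E(c^0)[\mathbb N]]]^{sf}$ is, with the induced action, a left $L_K(E)$-module (in particular unitary).
   Context: Leavitt path algebras. $E=(E^0,E^1,s,r)$ is an arbitrary directed graph and $K$ a field. $L_K(E)$ is the $K$-algebra generated by $E^0\cup E^1\cup\{e^*: e\in E^1\}$ subject to: vertices are orthogonal idempotents; $s(e)e=e=e\,r(e)$ and $r(e)e^*=e^*=e^*s(e)$; $e^*f=\delta_{e,f}\,r(e)$; and $u=\sum_{e\in s^{-1}(u)}ee^*$ for every vertex $u$ with $0<|s^{-1}(u)|<\infty$. Paths are written $e_1\cdots e_m$ with $r(e_i)=s(e_{i+1})$; vertices are paths of length 0. A left $L_K(E)$-premodule is an abelian group with a standard left module action of the (possibly nonunital) ring $L_K(E)$; a left module is a premodule $M$ that is unitary, i.e. $L_K(E)M=M$. Cycles. A cycle is a path $c=e_1\cdots e_n$ ($n\ge1$) with $r(e_n)=s(e_1)$ and $s(e_1),\dots,s(e_n)$ distinct. Put $v_i=s(e_i)$, $v=v_1=s(c)$, $c^0=\{v_1,\dots,v_n\}$. $c$ is exclusive if no vertex of $c^0$ is the base of a cycle other than the corresponding cyclic permutation of $c$. The set $F^+_E(c^0)$. $T(v)$ is the set of vertices $w$ for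 which there is a path in $E$ from $v$ to $w$. $F^+_E(c^0)$ is the union of $c^0$ and the set of all paths $f_1\cdots f_m$ ($m\ge1$) with $s(f_1)\notin T(v)$, $r(f_i)\notin T(v)$ for $1\le i<m$, and $r(f_m)\in c^0$. Formal series. $\mathbb N=\{1,2,\dots\}$. $K[[F^+_E(c^0)[\mathbb N]]]$ is the $K$-space of functions $\mathfrak p:F^+_E(c^0)\times\mathbb N\to K$ such that for each $\mu$ one has $\mathfrak p(\mu,i)=0$ for almost all $i$. $K[[F^+_E(c^0)[\mathbb N]]]^{sf}$ is the subspace of source finite functions, i.e. those for which $\{s(\mu):\mathfrak p(\mu,i)\ne0\text{ for some }i\}$ is finite. Operators. $P_u(\mathfrak p)(\mu,i)=\mathfrak p(\mu,i)$ if $s(\mu)=u$, and $0$ otherwise. If $s(e)\notin c^0$: $S_e(\mathfrak p)(\mu,i)=\mathfrak p(\mu',i)$ if $\mu=e\mu'$ with $\mu'\in F^+_E(c^0)$, and $0$ otherwise; $S_{e^*}(\mathfrak p)(\mu,i)=\mathfrak p(e\mu,i)$ if $s(\mu)=r(e)$, and $0$ otherwise. If $s(e)\in c^0$: $S_e(\mathfrak p)(\mu,i)$ equals $\mathfrak p(r(e),i)$ if $\mu=s(e)$ and $v\ne r(e)\in c^0$; equals $\mathfrak p(v,i+1)+\mathfrak p(v,i)$ if $\mu=s(e)$ and $r(e)=v$; and is $0$ otherwise. $S_{e^*}(\mathfrak p)(\mu,i)$ equals $\mathfrak p(s(e),i)$ if $\mu=r(e)\ne v$; equals $\sum_{j\ge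 i}(-1)^{j-i}\mathfrak p(s(e),j)$ (a finite sum) if $\mu=r(e)=v$; and is $0$ otherwise. *)

theory Defs
  imports
    "HOL-Algebra.Algebra"
    "HOL-Algebra.Algebraic_Closure_Type"
    "HOL-Library.Poly_Mapping"
    "Graph_Theory.Arc_Walk"
begin

section \<open>Free associative algebras\<close>

text \<open>
  Words, written additively: then finitely supported functions on words with
  the convolution product of \<^theory>\<open>HOL-Library.Poly_Mapping\<close> are the noncommutative
  polynomials, and scalars (multiples of the empty word) are central.
\<close>

datatype 'x fmonoid = FM (letters: "'x list")

instantiation fmonoid :: (type) monoid_add
begin

definition zero_fmonoid :: "'x fmonoid" where
  "zero_fmonoid = FM []"

definition plus_fmonoid :: "'x fmonoid \<Rightarrow> 'x fmonoid \<Rightarrow> 'x fmonoid" where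
  "plus_fmonoid w w' = FM (letters w @ letters w')"

instance
  by standard (auto simp: zero_fmonoid_def plus_fmonoid_def)

end

type_synonym ('x, 'k) ncpoly = "'x fmonoid \<Rightarrow>\<^sub>0 'k"

definition scalar :: "'k::field \<Rightarrow> ('x, 'k) ncpoly" where
  "scalar k = Poly_Mapping.single 0 k"

definition gen :: "'x \<Rightarrow> ('x, 'k::field) ncpoly" where
  "gen x = Poly_Mapping.single (FM [x]) 1"

definition free_algebra :: "'x set \<Rightarrow> ('x, 'k::field) ncpoly ring" where
  "free_algebra S = \<lparr>carrier = {f. \<forall>w \<in> Poly_Mapping.keys f. set (letters w) \<subseteq> S},
     monoid.mult = (*), one = 1, ring.zero = 0, add = (+)\<rparr>"

lemma ring_free_algebra: "ring (free_algebra S :: ('x, 'k::field) ncpoly ring)"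
proof -
  let ?A = "free_algebra S :: ('x, 'k) ncpoly ring"
  have keys_neg: "Poly_Mapping.keys (- f) = Poly_Mapping.keys f" for f :: "('x, 'k) ncpoly"
    by (auto simp: in_keys_iff)
  have carrier: "f \<in> carrier ?A \<longleftrightarrow> (\<forall>w \<in> Poly_Mapping.keys f. set (letters w) \<subseteq> S)" for f
    by (simp add: free_algebra_def)
  have add: "f + g \<in> carrier ?A" if "f \<in> carrier ?A" "g \<in> carrier ?A" for f g
    using that Poly_Mapping.keys_add[of f g] unfolding carrier by blast
  have neg: "- f \<in> carrier ?A" if "f \<in> carrier ?A" for f
    using that unfolding carrier keys_neg .
  have mult: "f * g \<in> carrier ?A" if "f \<in> carrier ?A" "g \<in> carrier ?A" for f g
    unfolding carrier
  proof
    fix w assume "w \<in> Poly_Mapping.keys (f * g)"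
    then obtain a b where "w = a + b" "a \<in> Poly_Mapping.keys f" "b \<in> Poly_Mapping.keys g"
      using keys_mult[of f g] by blast
    moreover from this have "set (letters a) \<subseteq> S" "set (letters b) \<subseteq> S"
      using that unfolding carrier by blast+
    ultimately show "set (letters w) \<subseteq> S"
      by (simp add: plus_fmonoid_def)
  qed
  have zero: "0 \<in> carrier ?A" and one: "1 \<in> carrier ?A"
    unfolding carrier by (simp_all add: zero_fmonoid_def)
  have ops: "f \<otimes>\<^bsub>?A\<^esub> g = f * g" "f \<oplus>\<^bsub>?A\<^esub> g = f + g" "\<one>\<^bsub>?A\<^esub> = 1" "\<zero>\<^bsub>?A\<^esub> = 0" for f g
    by (simp_all add: free_algebra_def)
  show ?thesis
  proof (intro ringI abelian_groupI monoidI, unfold ops, goal_cases)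
    case (6 f)
    then show ?case
      using neg by (intro bexI[of _ "- f"]) simp_all
  qed (fact add mult zero one | rule add.assoc add.commute mult.assoc distrib_left distrib_right
      | simp)+
qed

section \<open>Modules over possibly nonunital rings\<close>

text \<open>The field \<open>one\<close> of the record is ignored here; it need not lie in the carrier.\<close>

locale nonunital_ring = abelian_group R for R (structure) +
  assumes m_closed: "\<lbrakk>a \<in> carrier R; b \<in> carrier R\<rbrakk> \<Longrightarrow> a \<otimes> b \<in> carrier R"
    and m_assoc: "\<lbrakk>a \<in> carrier R; b \<in> carrier R; d \<in> carrier R\<rbrakk>
      \<Longrightarrow> (a \<otimes> b) \<otimes> d = a \<otimes> (b \<otimes> d)"
    and l_distr: "\<lbrakk>a \<in> carrier R; b \<in> carrier R; d \<in> carrier R\<rbrakk>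
      \<Longrightarrow> (a \<oplus> b) \<otimes> d = a \<otimes> d \<oplus> b \<otimes> d"
    and r_distr: "\<lbrakk>a \<in> carrier R; b \<in> carrier R; d \<in> carrier R\<rbrakk>
      \<Longrightarrow> d \<otimes> (a \<oplus> b) = d \<otimes> a \<oplus> d \<otimes> b"

locale left_premodule =
  R: nonunital_ring R + M: abelian_group M
  for R (structure) and M (structure) and act +
  assumes act_closed: "\<lbrakk>a \<in> carrier R; x \<in> carrier M\<rbrakk> \<Longrightarrow> act a x \<in> carrier M"
    and act_add_left: "\<lbrakk>a \<in> carrier R; b \<in> carrier R; x \<in> carrier M\<rbrakk>
      \<Longrightarrow> act (a \<oplus>\<^bsub>R\<^esub> b) x = act a x \<oplus>\<^bsub>M\<^esub> act b x"
    and act_add_right: "\<lbrakk>a \<in> carrier R; x \<in> carrier M; y \<in> carrier M\<rbrakk>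
      \<Longrightarrow> act a (x \<oplus>\<^bsub>M\<^esub> y) = act a x \<oplus>\<^bsub>M\<^esub> act a y"
    and act_mult: "\<lbrakk>a \<in> carrier R; b \<in> carrier R; x \<in> carrier M\<rbrakk>
      \<Longrightarrow> act (a \<otimes>\<^bsub>R\<^esub> b) x = act a (act b x)"

locale left_module = left_premodule R M act
  for R (structure) and M (structure) and act +
  assumes unitary: "x \<in> carrier M \<Longrightarrow> \<exists>(n::nat) a y.
      (\<forall>i<n. a i \<in> carrier R \<and> y i \<in> carrier M) \<and>
      x = (\<Oplus>\<^bsub>M\<^esub>i\<in>{..<n}. act (a i) (y i))"

section \<open>Leavitt path algebras\<close>

datatype ('v, 'e) lpa_gen = Vertex 'v | Edge 'e | Ghost 'e

definition lpa_gens :: "('v, 'e) pre_digraph \<Rightarrow> ('v, 'e) lpa_gen set" where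
  "lpa_gens E = Vertex ` verts E \<union> Edge ` arcs E \<union> Ghost ` arcs E"

definition lpa_relations ::
    "('v, 'e) pre_digraph \<Rightarrow> (('v, 'e) lpa_gen, 'k::field) ncpoly set" where
  "lpa_relations E =
     {gen (Vertex u) * gen (Vertex w) - (if u = w then gen (Vertex u) else 0)
       | u w. u \<in> verts E \<and> w \<in> verts E}
   \<union> {gen (Vertex (tail E e)) * gen (Edge e) - gen (Edge e) | e. e \<in> arcs E}
   \<union> {gen (Edge e) * gen (Vertex (head E e)) - gen (Edge e) | e. e \<in> arcs E}
   \<union> {gen (Vertex (head E e)) * gen (Ghost e) - gen (Ghost e) | e. e \<in> arcs E}
   \<union> {gen (Ghost e) * gen (Vertex (tail E e)) - gen (Ghost e) | e. e \<in> arcs E}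
   \<union> {gen (Ghost e) * gen (Edge f) - (if e = f then gen (Vertex (head E e)) else 0)
       | e f. e \<in> arcs E \<and> f \<in> arcs E}
   \<union> {gen (Vertex u) - (\<Sum>e\<in>out_arcs E u. gen (Edge e) * gen (Ghost e))
       | u. u \<in> verts E \<and> finite (out_arcs E u) \<and> out_arcs E u \<noteq> {}}"

definition lpa_free :: "('v, 'e) pre_digraph \<Rightarrow> (('v, 'e) lpa_gen, 'k::field) ncpoly ring" where
  "lpa_free E = free_algebra (lpa_gens E)"

definition lpa_ideal :: "('v, 'e) pre_digraph \<Rightarrow> (('v, 'e) lpa_gen, 'k::field) ncpoly set" where
  "lpa_ideal E = Idl\<^bsub>lpa_free E\<^esub> (lpa_relations E)"

definition lpa_class ::
    "('v, 'e) pre_digraph \<Rightarrow> (('v, 'e) lpa_gen, 'k::field) ncpoly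
      \<Rightarrow> (('v, 'e) lpa_gen, 'k) ncpoly set" where
  "lpa_class E f = lpa_ideal E +>\<^bsub>lpa_free E\<^esub> f"

text \<open>
  The algebra generated by the vertices, edges and ghost edges need not be unital, so it
  consists of the classes of the polynomials without constant term.  (The relations have no
  constant term, so this is the quotient of the free nonunital algebra by the ideal
  generated by them.)  The field \<open>one\<close>, the unit of the quotient of the unital free
  algebra, is irrelevant.
\<close>

definition leavitt ::
    "('v, 'e) pre_digraph \<Rightarrow> ('k::field, (('v, 'e) lpa_gen, 'k) ncpoly set) module" where
  "leavitt E = (let Q = lpa_free E Quot lpa_ideal E in
    \<lparr>carrier = {lpa_class E f | f. f \<in> carrier (lpa_free E) \<and> Poly_Mapping.lookup f 0 = 0},
     monoid.mult = monoid.mult Q, one = monoid.one Q, ring.zero = ring.zero Q, add = ring.add Q,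
     module.smult = (\<lambda>k A. lpa_class E (scalar k) \<otimes>\<^bsub>Q\<^esub> A)\<rparr>)"

section \<open>Paths and exclusive cycles\<close>

text \<open>
  A path is a pair of its source and its list of edges, so that the paths of length 0
  are the pairs \<open>(u, [])\<close>.
\<close>

type_synonym ('v, 'e) path = "'v \<times> 'e list"

definition cycle_base :: "('v, 'e) pre_digraph \<Rightarrow> 'e list \<Rightarrow> 'v" where
  "cycle_base E c = tail E (hd c)"

definition cycle_verts :: "('v, 'e) pre_digraph \<Rightarrow> 'e list \<Rightarrow> 'v set" where
  "cycle_verts E c = tail E ` set c"

definition exclusive_cycle :: "('v, 'e) pre_digraph \<Rightarrow> 'e list \<Rightarrow> bool" where
  "exclusive_cycle E c \<longleftrightarrow> pre_digraph.cycle E c \<and>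
     (\<forall>i<length c. \<forall>d. pre_digraph.cycle E d \<and> cycle_base E d = tail E (c ! i)
        \<longrightarrow> d = rotate i c)"

definition tree :: "('v, 'e) pre_digraph \<Rightarrow> 'v \<Rightarrow> 'v set" where
  "tree E v = {w. \<exists>p. pre_digraph.awalk E v p w}"

definition Fplus :: "('v, 'e) pre_digraph \<Rightarrow> 'e list \<Rightarrow> ('v, 'e) path set" where
  "Fplus E c = {(u, []) | u. u \<in> cycle_verts E c} \<union>
     {(u, fs) | u fs w. fs \<noteq> [] \<and> pre_digraph.awalk E u fs w
        \<and> u \<notin> tree E (cycle_base E c)
        \<and> (\<forall>f \<in> set (butlast fs). head E f \<notin> tree E (cycle_base E c))
        \<and> w \<in> cycle_verts E c}"

section \<open>Formal series and the operators\<close>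

text \<open>
  Functions on \<open>Fplus E c \<times> {1, 2, \<dots>}\<close> are represented by total functions vanishing
  outside of this domain.
\<close>

type_synonym ('v, 'e, 'k) series = "('v, 'e) path \<Rightarrow> nat \<Rightarrow> 'k"

definition on_domain :: "('v, 'e) pre_digraph \<Rightarrow> 'e list \<Rightarrow> ('v, 'e, 'k::field) series
    \<Rightarrow> ('v, 'e, 'k) series" where
  "on_domain E c p = (\<lambda>\<mu> i. if \<mu> \<in> Fplus E c \<and> 1 \<le> i then p \<mu> i else 0)"

definition series_space ::
    "('v, 'e) pre_digraph \<Rightarrow> 'e list \<Rightarrow> ('k::field, ('v, 'e, 'k) series) module" where
  "series_space E c =
    \<lparr>carrier = {p. (\<forall>\<mu> i. \<mu> \<notin> Fplus E c \<or> i < 1 \<longrightarrow> p \<mu> i = 0)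
                  \<and> (\<forall>\<mu>. finite {i. p \<mu> i \<noteq> 0})},
     monoid.mult = undefined, one = undefined,
     ring.zero = (\<lambda>\<mu> i. 0), add = (\<lambda>p q \<mu> i. p \<mu> i + q \<mu> i),
     module.smult = (\<lambda>k p \<mu> i. k * p \<mu> i)\<rparr>"

definition series_space_sf ::
    "('v, 'e) pre_digraph \<Rightarrow> 'e list \<Rightarrow> ('k::field, ('v, 'e, 'k) series) module" where
  "series_space_sf E c = series_space E c
    \<lparr>carrier := {p \<in> carrier (series_space E c). finite {fst \<mu> | \<mu>. \<exists>i. p \<mu> i \<noteq> 0}}\<rparr>"

definition op_vertex :: "('v, 'e) pre_digraph \<Rightarrow> 'e list \<Rightarrow> 'v
    \<Rightarrow> ('v, 'e, 'k::field) series \<Rightarrow> ('v, 'e, 'k) series" where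
  "op_vertex E c u p = on_domain E c (\<lambda>\<mu> i. if fst \<mu> = u then p \<mu> i else 0)"

definition op_edge :: "('v, 'e) pre_digraph \<Rightarrow> 'e list \<Rightarrow> 'e
    \<Rightarrow> ('v, 'e, 'k::field) series \<Rightarrow> ('v, 'e, 'k) series" where
  "op_edge E c e p = on_domain E c
    (if tail E e \<notin> cycle_verts E c then
       (\<lambda>(u, fs) i. case fs of
            [] \<Rightarrow> 0
          | f # fs' \<Rightarrow> if f = e \<and> (head E e, fs') \<in> Fplus E c then p (head E e, fs') i else 0)
     else
       (\<lambda>\<mu> i. if \<mu> = (tail E e, []) then
          if head E e = cycle_base E c then
            p (cycle_base E c, []) (i + 1) + p (cycle_base E c, []) i
          else if head E e \<in> cycle_verts E c then p (head E e, []) i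
          else 0
        else 0))"

text \<open>
  In \<open>op_ghost\<close> the sum over all \<open>j \<ge> i\<close> is restricted to the nonzero terms, which are finitely
  many for members of \<open>series_space\<close>.
\<close>

definition op_ghost :: "('v, 'e) pre_digraph \<Rightarrow> 'e list \<Rightarrow> 'e
    \<Rightarrow> ('v, 'e, 'k::field) series \<Rightarrow> ('v, 'e, 'k) series" where
  "op_ghost E c e p = on_domain E c
    (if tail E e \<notin> cycle_verts E c then
       (\<lambda>(u, fs) i. if u = head E e then p (tail E e, e # fs) i else 0)
     else
       (\<lambda>\<mu> i. if \<mu> = (head E e, []) then
          if head E e = cycle_base E c then
            (\<Sum>j | i \<le> j \<and> p (tail E e, []) j \<noteq> 0. (-1) ^ (j - i) * p (tail E e, []) j)
          else p (tail E e, []) i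
        else 0))"

section \<open>Actions of the Leavitt path algebra on spaces of series\<close>

definition bilinear_action :: "('k, 'a) module \<Rightarrow> ('k, 'b) module \<Rightarrow> ('a \<Rightarrow> 'b \<Rightarrow> 'b) \<Rightarrow> bool" where
  "bilinear_action A M act \<longleftrightarrow>
     (\<forall>k. \<forall>a \<in> carrier A. \<forall>x \<in> carrier M.
        act (k \<odot>\<^bsub>A\<^esub> a) x = k \<odot>\<^bsub>M\<^esub> act a x \<and> act a (k \<odot>\<^bsub>M\<^esub> x) = k \<odot>\<^bsub>M\<^esub> act a x)"

definition extends_operators ::
    "('v, 'e) pre_digraph \<Rightarrow> 'e list
      \<Rightarrow> ((('v, 'e) lpa_gen, 'k::field) ncpoly set \<Rightarrow> ('v, 'e, 'k) series \<Rightarrow> ('v, 'e, 'k) series)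
      \<Rightarrow> bool" where
  "extends_operators E c act \<longleftrightarrow>
     (\<forall>p \<in> carrier (series_space E c).
        (\<forall>u \<in> verts E. act (lpa_class E (gen (Vertex u))) p = op_vertex E c u p) \<and>
        (\<forall>e \<in> arcs E. act (lpa_class E (gen (Edge e))) p = op_edge E c e p) \<and>
        (\<forall>e \<in> arcs E. act (lpa_class E (gen (Ghost e))) p = op_ghost E c e p))"

end

theory Submission
  imports Defs "HOL-Library.Function_Algebras"
begin

text \<open>
  It suffices to check that the operators satisfy the defining relations: they then extend to the
  free algebra, and the polynomials acting as zero form an ideal containing the relations.  Two
  facts about an exclusive cycle \<open>c\<close> make the relations work.  An arc that starts on \<open>c\<close> and from
  whose head \<open>c\<close> can be reached lies on \<open>c\<close>; hence every vertex of \<open>c\<close> emits exactly one arc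
  between vertices of \<open>c\<close>, and no vertex of \<open>T(v)\<close> outside \<open>c\<close> leads back to \<open>c\<close>.  Therefore
  prepending an arc that starts off \<open>c\<close> never leads out of \<open>Fplus\<close>.  On sequences of finite
  support, \<open>1 + shift\<close> is invertible with inverse the alternating tail sum, which makes the arcs
  of \<open>c\<close> act invertibly.  A source finite series is the finite sum of its images under the
  vertices, so the submodule of these is unitary.
\<close>

section \<open>Representations of free algebras\<close>

lemma free_algebra_simps:
  "f \<in> carrier (free_algebra S) \<longleftrightarrow> (\<forall>w \<in> Poly_Mapping.keys f. set (letters w) \<subseteq> S)"
  "f \<otimes>\<^bsub>free_algebra S\<^esub> g = f * g" "f \<oplus>\<^bsub>free_algebra S\<^esub> g = f + g"
  "\<one>\<^bsub>free_algebra S\<^esub> = 1" "\<zero>\<^bsub>free_algebra S\<^esub> = 0"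
  by (simp_all add: free_algebra_def)

lemma a_inv_free_algebra:
  fixes f :: "('x, 'k::field) ncpoly"
  assumes "f \<in> carrier (free_algebra S)"
  shows "\<ominus>\<^bsub>free_algebra S\<^esub> f = - f"
proof -
  interpret ring "free_algebra S :: ('x, 'k) ncpoly ring" by (rule ring_free_algebra)
  have "- f \<in> carrier (free_algebra S)"
    using assms by (simp add: free_algebra_simps)
  moreover have "- f \<oplus>\<^bsub>free_algebra S\<^esub> f = \<zero>\<^bsub>free_algebra S\<^esub>"
    by (simp add: free_algebra_simps)
  ultimately show ?thesis
    using assms minus_equality by blast
qed

lemma free_algebra_closed:
  fixes f g :: "('x, 'k::field) ncpoly"
  assumes "f \<in> carrier (free_algebra S)" "g \<in> carrier (free_algebra S)"
  shows "f + g \<in> carrier (free_algebra S)" "f - g \<in> carrier (free_algebra S)"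
    "f * g \<in> carrier (free_algebra S)"
proof -
  interpret ring "free_algebra S :: ('x, 'k) ncpoly ring" by (rule ring_free_algebra)
  show "f + g \<in> carrier (free_algebra S)" "f - g \<in> carrier (free_algebra S)"
    "f * g \<in> carrier (free_algebra S)"
    using add.m_closed[OF assms] minus_closed[OF assms] m_closed[OF assms]
    by (simp_all add: a_minus_def a_inv_free_algebra assms free_algebra_simps(2-))
qed

lemma uminus_in_free_algebra:
  "f \<in> carrier (free_algebra S) \<Longrightarrow> - f \<in> carrier (free_algebra S)"
  by (simp add: free_algebra_simps)

lemma zero_in_free_algebra: "0 \<in> carrier (free_algebra S)"
  by (simp add: free_algebra_simps)

lemma sum_in_free_algebra:
  "(\<And>a. a \<in> A \<Longrightarrow> f a \<in> carrier (free_algebra S)) \<Longrightarrow>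
    (\<Sum>a\<in>A. f a) \<in> carrier (free_algebra S)"
  by (induction A rule: infinite_finite_induct) (auto intro: free_algebra_closed zero_in_free_algebra)

lemma gen_in_free_algebra: "x \<in> S \<Longrightarrow> gen x \<in> carrier (free_algebra S)"
  by (simp add: free_algebra_simps gen_def)

lemma scalar_in_free_algebra: "scalar k \<in> carrier (free_algebra S)"
  by (simp add: free_algebra_simps scalar_def zero_fmonoid_def)

text \<open>The empty word factors only into two empty words. Hence polynomials without constant
  term are closed under multiplication, as the carrier of \<open>leavitt E\<close> requires.\<close>

lemma lookup_mult_0:
  fixes f g :: "('x, 'k::field) ncpoly"
  assumes "Poly_Mapping.lookup f 0 = 0 \<or> Poly_Mapping.lookup g 0 = 0"
  shows "Poly_Mapping.lookup (f * g) 0 = 0"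
proof (rule ccontr)
  assume "Poly_Mapping.lookup (f * g) 0 \<noteq> 0"
  then obtain a b :: "'x fmonoid" where "0 = a + b" "a \<in> Poly_Mapping.keys f" "b \<in> Poly_Mapping.keys g"
    using keys_mult[of f g] by (auto simp: in_keys_iff)
  moreover from this have "a = 0" "b = 0"
    by (auto simp: zero_fmonoid_def plus_fmonoid_def intro: fmonoid.expand)
  ultimately show False
    using assms by (simp add: in_keys_iff)
qed

lemma ncpoly_eq_sum_single:
  "f = (\<Sum>w\<in>Poly_Mapping.keys f. Poly_Mapping.single w (Poly_Mapping.lookup f w))"
  by (rule poly_mapping_eqI) (simp add: lookup_sum lookup_single when_def in_keys_iff)

lemma ncpoly_mult_eq_sum:
  fixes f g :: "('x, 'k::field) ncpoly"
  shows "f * g = (\<Sum>a\<in>Poly_Mapping.keys f. \<Sum>b\<in>Poly_Mapping.keys g.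
    Poly_Mapping.single (a + b) (Poly_Mapping.lookup f a * Poly_Mapping.lookup g b))"
  by (subst (1) ncpoly_eq_sum_single[of f], subst (1) ncpoly_eq_sum_single[of g])
    (simp add: sum_product mult_single)

text \<open>Controls the representative that \<open>quotient_act\<close> chooses from a coset: as a
  member of the coset of \<open>f\<close> it has the form of an element of \<open>I\<close> plus
  \<open>f\<close>.\<close>

lemma some_in_coset_diff:
  fixes I :: "('x, 'k::field) ncpoly set"
  assumes "ideal I (free_algebra S)" "f \<in> carrier (free_algebra S)"
  shows "(SOME g. g \<in> I +>\<^bsub>free_algebra S\<^esub> f) - f \<in> I"
proof -
  interpret ideal I "free_algebra S" by fact
  have "f \<in> I +>\<^bsub>free_algebra S\<^esub> f"
    using assms(2) by (rule a_rcos_self)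
  then have "(SOME g. g \<in> I +>\<^bsub>free_algebra S\<^esub> f) \<in> I +>\<^bsub>free_algebra S\<^esub> f"
    by (rule someI)
  then show ?thesis
    by (auto simp: a_r_coset_def' free_algebra_simps)
qed

text \<open>The vector space is a whole type, but the operators are linear on \<open>V\<close> only:
  a ghost edge of the cycle may act through a sum over a support, and for infinite supports this sum
  takes the default value 0, which breaks additivity.\<close>

locale free_algebra_rep = vector_space scale
  for scale :: "'k::field \<Rightarrow> 'b::ab_group_add \<Rightarrow> 'b" +
  fixes V :: "'b set" and S :: "'x set" and \<phi> :: "'x \<Rightarrow> 'b \<Rightarrow> 'b"
  assumes subspace_V: "subspace V"
    and \<phi>_closed: "\<lbrakk>x \<in> S; v \<in> V\<rbrakk> \<Longrightarrow> \<phi> x v \<in> V"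
    and \<phi>_add: "\<lbrakk>x \<in> S; v \<in> V; w \<in> V\<rbrakk> \<Longrightarrow> \<phi> x (v + w) = \<phi> x v + \<phi> x w"
    and \<phi>_scale: "\<lbrakk>x \<in> S; v \<in> V\<rbrakk> \<Longrightarrow> \<phi> x (scale k v) = scale k (\<phi> x v)"
begin

text \<open>With \<open>foldr\<close> the last letter acts first, so that concatenation becomes
  composition and the action is a left action.\<close>

definition word_act :: "'x fmonoid \<Rightarrow> 'b \<Rightarrow> 'b" where
  "word_act w = foldr \<phi> (letters w)"

text \<open>Depends on \<open>scale\<close> and \<open>\<phi>\<close> alone, neither on
  \<open>V\<close> nor on \<open>S\<close>. One function can therefore serve a space and an
  invariant subspace of it.\<close>

definition poly_act :: "('x, 'k) ncpoly \<Rightarrow> 'b \<Rightarrow> 'b" where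
  "poly_act f v = (\<Sum>w\<in>Poly_Mapping.keys f. scale (Poly_Mapping.lookup f w) (word_act w v))"

lemma word_act_zero [simp]: "word_act 0 v = v"
  by (simp add: word_act_def zero_fmonoid_def)

lemma word_act_plus: "word_act (a + b) v = word_act a (word_act b v)"
  by (simp add: word_act_def plus_fmonoid_def)

lemma foldr_closed: "\<lbrakk>set xs \<subseteq> S; v \<in> V\<rbrakk> \<Longrightarrow> foldr \<phi> xs v \<in> V"
  by (induction xs) (auto intro: \<phi>_closed)

lemma word_act_closed: "\<lbrakk>set (letters w) \<subseteq> S; v \<in> V\<rbrakk> \<Longrightarrow> word_act w v \<in> V"
  by (simp add: word_act_def foldr_closed)

lemma word_act_add:
  assumes "set (letters w) \<subseteq> S" "u \<in> V" "v \<in> V"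
  shows "word_act w (u + v) = word_act w u + word_act w v"
proof -
  have "foldr \<phi> xs (u + v) = foldr \<phi> xs u + foldr \<phi> xs v" if "set xs \<subseteq> S" for xs
    using that assms(2,3) by (induction xs) (auto simp: \<phi>_add foldr_closed)
  then show ?thesis
    using assms(1) by (simp add: word_act_def)
qed

lemma word_act_scale:
  assumes "set (letters w) \<subseteq> S" "v \<in> V"
  shows "word_act w (scale k v) = scale k (word_act w v)"
proof -
  have "foldr \<phi> xs (scale k v) = scale k (foldr \<phi> xs v)" if "set xs \<subseteq> S" for xs
    using that assms(2) by (induction xs) (auto simp: \<phi>_scale foldr_closed)
  then show ?thesis
    using assms(1) by (simp add: word_act_def)
qed

lemma word_act_sum:
  assumes w: "set (letters w) \<subseteq> S" and "finite B" "\<And>b. b \<in> B \<Longrightarrow> v b \<in> V"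
  shows "word_act w (\<Sum>b\<in>B. v b) = (\<Sum>b\<in>B. word_act w (v b))"
  using assms(2,3)
proof (induction B rule: finite_induct)
  case empty
  \<comment> \<open>Writing the zero vector as \<open>scale 0 0\<close> lets homogeneity give
    \<open>word_act w 0 = 0\<close>.\<close>
  have "word_act w (scale 0 0) = scale 0 (word_act w 0)"
    using w subspace_0[OF subspace_V] by (rule word_act_scale)
  then show ?case by simp
next
  case (insert b B)
  then have "(\<Sum>b\<in>B. v b) \<in> V"
    by (intro subspace_sum[OF subspace_V]) auto
  with insert w show ?case
    by (simp add: word_act_add)
qed

text \<open>Coefficients off the support vanish, so polynomials with different supports can be
  summed over one common index set.\<close>

lemma poly_act_superset:
  assumes "finite A" "Poly_Mapping.keys f \<subseteq> A"
  shows "poly_act f v = (\<Sum>w\<in>A. scale (Poly_Mapping.lookup f w) (word_act w v))"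
  unfolding poly_act_def by (rule sum.mono_neutral_left) (use assms in \<open>auto simp: in_keys_iff\<close>)

lemma poly_act_add: "poly_act (f + g) v = poly_act f v + poly_act g v"
proof -
  let ?A = "Poly_Mapping.keys f \<union> Poly_Mapping.keys g"
  have "poly_act h v = (\<Sum>w\<in>?A. scale (Poly_Mapping.lookup h w) (word_act w v))"
    if "Poly_Mapping.keys h \<subseteq> ?A" for h
    using that by (intro poly_act_superset) auto
  then show ?thesis
    by (simp add: Poly_Mapping.keys_add lookup_add scale_left_distrib sum.distrib)
qed

lemma poly_act_zero [simp]: "poly_act 0 v = 0"
  by (simp add: poly_act_def)

lemma poly_act_diff: "poly_act (f - g) v = poly_act f v - poly_act g v"
  using poly_act_add[of "f - g" g v] by simp

lemma poly_act_uminus: "poly_act (- f) v = - poly_act f v"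
  using poly_act_diff[of 0 f v] by simp

lemma poly_act_sum: "poly_act (\<Sum>a\<in>A. f a) v = (\<Sum>a\<in>A. poly_act (f a) v)"
  by (induction A rule: infinite_finite_induct) (simp_all add: poly_act_add)

lemma poly_act_single: "poly_act (Poly_Mapping.single w k) v = scale k (word_act w v)"
  by (simp add: poly_act_def)

lemma poly_act_gen [simp]: "poly_act (gen x) v = \<phi> x v"
  by (simp add: gen_def poly_act_single word_act_def)

lemma poly_act_scalar [simp]: "poly_act (scalar k) v = scale k v"
  by (simp add: scalar_def poly_act_single)

lemma poly_act_closed:
  "\<lbrakk>f \<in> carrier (free_algebra S); v \<in> V\<rbrakk> \<Longrightarrow> poly_act f v \<in> V"
  unfolding poly_act_def
  by (intro subspace_sum[OF subspace_V] subspace_scale[OF subspace_V] word_act_closed)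
    (auto simp: free_algebra_simps)

lemma poly_act_add_right:
  assumes "f \<in> carrier (free_algebra S)" "u \<in> V" "v \<in> V"
  shows "poly_act f (u + v) = poly_act f u + poly_act f v"
  unfolding poly_act_def sum.distrib[symmetric]
  by (rule sum.cong) (use assms in \<open>auto simp: free_algebra_simps word_act_add scale_right_distrib\<close>)

lemma poly_act_scale_right:
  assumes "f \<in> carrier (free_algebra S)" "v \<in> V"
  shows "poly_act f (scale k v) = scale k (poly_act f v)"
  unfolding poly_act_def scale_sum_right
  by (rule sum.cong) (use assms in \<open>auto simp: free_algebra_simps word_act_scale mult.commute\<close>)

text \<open>On words this is \<open>word_act_plus\<close>. Both factors are expanded into monomials,
  and linearity of \<open>word_act a\<close> on \<open>V\<close> moves it past the sum over the
  monomials of \<open>g\<close>.\<close>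

lemma poly_act_mult:
  assumes f: "f \<in> carrier (free_algebra S)" and g: "g \<in> carrier (free_algebra S)" and v: "v \<in> V"
  shows "poly_act (f * g) v = poly_act f (poly_act g v)"
proof -
  have "poly_act (f * g) v = (\<Sum>a\<in>Poly_Mapping.keys f. \<Sum>b\<in>Poly_Mapping.keys g.
      scale (Poly_Mapping.lookup f a * Poly_Mapping.lookup g b) (word_act (a + b) v))"
    by (subst ncpoly_mult_eq_sum) (simp add: poly_act_sum poly_act_single)
  also have "\<dots> = (\<Sum>a\<in>Poly_Mapping.keys f.
      scale (Poly_Mapping.lookup f a) (word_act a (poly_act g v)))"
  proof (rule sum.cong[OF refl])
    fix a assume "a \<in> Poly_Mapping.keys f"
    then have a: "set (letters a) \<subseteq> S"
      using f by (simp add: free_algebra_simps)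
    have b: "word_act b v \<in> V" if "b \<in> Poly_Mapping.keys g" for b
      using that g v by (simp add: free_algebra_simps word_act_closed)
    have "word_act a (poly_act g v) = (\<Sum>b\<in>Poly_Mapping.keys g.
        word_act a (scale (Poly_Mapping.lookup g b) (word_act b v)))"
      unfolding poly_act_def using a b by (intro word_act_sum subspace_scale[OF subspace_V]) auto
    then show "(\<Sum>b\<in>Poly_Mapping.keys g.
        scale (Poly_Mapping.lookup f a * Poly_Mapping.lookup g b) (word_act (a + b) v)) =
        scale (Poly_Mapping.lookup f a) (word_act a (poly_act g v))"
      using a b by (simp add: scale_sum_right word_act_plus word_act_scale)
  qed
  finally show ?thesis
    by (simp add: poly_act_def)
qed

section \<open>Annihilators and descent of the action to a quotient\<close>

definition annihilator :: "('x, 'k) ncpoly set" where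
  "annihilator = {f \<in> carrier (free_algebra S). \<forall>v\<in>V. poly_act f v = 0}"

text \<open>For \<open>f\<close> in the annihilator, \<open>g * f\<close> acts as \<open>g\<close>
  applied to 0, and \<open>f * g\<close> acts as \<open>f\<close> applied to a vector that is again
  in \<open>V\<close>.\<close>

lemma ideal_annihilator: "ideal annihilator (free_algebra S)"
proof (rule idealI)
  let ?A = "free_algebra S :: ('x, 'k) ncpoly ring"
  show "ring ?A" by (rule ring_free_algebra)
  have poly_act_0: "poly_act f 0 = 0" if "f \<in> carrier ?A" for f
    using poly_act_scale_right[OF that subspace_0[OF subspace_V], of 0] by simp
  show "subgroup annihilator (add_monoid ?A)"
  proof (rule subgroup.intro, goal_cases)
    case (2 f g)
    then show ?case
      by (auto simp: annihilator_def free_algebra_simps(3) free_algebra_closed poly_act_add)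
  next
    case (4 f)
    then have "f \<in> carrier ?A"
      by (simp add: annihilator_def)
    with 4 have "\<ominus>\<^bsub>?A\<^esub> f \<in> annihilator"
      by (auto simp: annihilator_def a_inv_free_algebra uminus_in_free_algebra poly_act_uminus)
    then show ?case
      by (simp add: a_inv_def)
  qed (auto simp: annihilator_def free_algebra_simps(5) zero_in_free_algebra)
  fix f g assume fg: "f \<in> annihilator" "g \<in> carrier ?A"
  then show "g \<otimes>\<^bsub>?A\<^esub> f \<in> annihilator" "f \<otimes>\<^bsub>?A\<^esub> g \<in> annihilator"
    using poly_act_0
    by (auto simp: annihilator_def free_algebra_simps(2) free_algebra_closed poly_act_mult poly_act_closed)
qed

end

locale presented_algebra_rep = free_algebra_rep scale V S \<phi>
  for scale :: "'k::field \<Rightarrow> 'b::ab_group_add \<Rightarrow> 'b" and V S and \<phi> :: "'x \<Rightarrow> 'b \<Rightarrow> 'b" +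
  fixes rels :: "('x, 'k) ncpoly set"
  assumes rels: "rels \<subseteq> annihilator"
begin

abbreviation relation_ideal :: "('x, 'k) ncpoly set" where
  "relation_ideal \<equiv> Idl\<^bsub>free_algebra S\<^esub> rels"

definition quotient_act :: "('x, 'k) ncpoly set \<Rightarrow> 'b \<Rightarrow> 'b" where
  "quotient_act C v = poly_act (SOME f. f \<in> C) v"

lemma ideal_relation_ideal: "ideal relation_ideal (free_algebra S)"
  using rels by (intro ring.genideal_ideal ring_free_algebra) (auto simp: annihilator_def)

lemma relation_ideal_subset: "relation_ideal \<subseteq> annihilator"
  by (rule ring.genideal_minimal[OF ring_free_algebra ideal_annihilator rels])

text \<open>Makes the choice in \<open>quotient_act\<close> harmless: the chosen polynomial and
  \<open>f\<close> differ by an element of the relation ideal, which lies inside the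
  annihilator.\<close>

lemma quotient_act_coset:
  assumes "f \<in> carrier (free_algebra S)" "v \<in> V"
  shows "quotient_act (relation_ideal +>\<^bsub>free_algebra S\<^esub> f) v = poly_act f v"
proof -
  let ?g = "SOME g. g \<in> relation_ideal +>\<^bsub>free_algebra S\<^esub> f"
  have "?g - f \<in> annihilator"
    using some_in_coset_diff[OF ideal_relation_ideal assms(1)] relation_ideal_subset by blast
  then have "poly_act ?g v - poly_act f v = 0"
    using assms(2) by (simp add: annihilator_def flip: poly_act_diff)
  then show ?thesis
    by (simp add: quotient_act_def)
qed

end

section \<open>The Leavitt path algebra as a presented algebra\<close>

lemma lpa_relations_subset:
  assumes "wf_digraph E"
  shows "lpa_relations E \<subseteq> carrier (lpa_free E)"
proof -
  interpret wf_digraph E by fact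
  have "u \<in> verts E \<Longrightarrow> gen (Vertex u) \<in> carrier (lpa_free E)"
    "e \<in> arcs E \<Longrightarrow> gen (Edge e) \<in> carrier (lpa_free E)"
    "e \<in> arcs E \<Longrightarrow> gen (Ghost e) \<in> carrier (lpa_free E)" for u e
    by (auto simp: lpa_free_def lpa_gens_def intro: gen_in_free_algebra)
  note gens = this[unfolded lpa_free_def]
  show ?thesis
    unfolding lpa_relations_def lpa_free_def
    by (auto intro!: free_algebra_closed sum_in_free_algebra gens zero_in_free_algebra
        simp: in_out_arcs_conv)
qed

locale leavitt_rep =
  wf_digraph E +
  presented_algebra_rep scale V "lpa_gens E" \<phi> "lpa_relations E"
  for E :: "('v, 'e) pre_digraph" and scale :: "'k::field \<Rightarrow> 'b::ab_group_add \<Rightarrow> 'b" and V \<phi>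

section \<open>Arithmetic of classes in the Leavitt path algebra\<close>

context
  fixes E :: "('v, 'e) pre_digraph"
  assumes wf: "wf_digraph E"
begin

lemma ideal_lpa_ideal: "ideal (lpa_ideal E) (lpa_free E)"
  unfolding lpa_ideal_def
  by (intro ring.genideal_ideal lpa_relations_subset[OF wf]) (simp add: lpa_free_def ring_free_algebra)

lemma lpa_class_hom: "ring_hom_ring (lpa_free E) (lpa_free E Quot lpa_ideal E) (lpa_class E)"
  using ideal.rcos_ring_hom_ring[OF ideal_lpa_ideal] by (simp add: lpa_class_def[abs_def])

lemma lpa_class_mult:
  assumes "f \<in> carrier (lpa_free E)" "g \<in> carrier (lpa_free E)"
  shows "lpa_class E f \<otimes>\<^bsub>leavitt E\<^esub> lpa_class E g = lpa_class E (f * g)"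
  using ring_hom_ring.homh[OF lpa_class_hom] assms ring_hom_mult
  by (fastforce simp: leavitt_def Let_def lpa_free_def free_algebra_simps)

lemma lpa_class_add:
  assumes "f \<in> carrier (lpa_free E)" "g \<in> carrier (lpa_free E)"
  shows "lpa_class E f \<oplus>\<^bsub>leavitt E\<^esub> lpa_class E g = lpa_class E (f + g)"
  using ring_hom_ring.homh[OF lpa_class_hom] assms ring_hom_add
  by (fastforce simp: leavitt_def Let_def lpa_free_def free_algebra_simps)

lemma lpa_class_smult:
  assumes "f \<in> carrier (lpa_free E)"
  shows "k \<odot>\<^bsub>leavitt E\<^esub> lpa_class E f = lpa_class E (scalar k * f)"
proof -
  have "scalar k \<in> carrier (lpa_free E)"
    by (simp add: lpa_free_def scalar_in_free_algebra)
  with lpa_class_mult[OF this assms] show ?thesis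
    by (simp add: leavitt_def Let_def)
qed

lemma lpa_class_zero: "\<zero>\<^bsub>leavitt E\<^esub> = (lpa_class E 0 :: (('v, 'e) lpa_gen, 'k::field) ncpoly set)"
proof -
  interpret ring_hom_ring "lpa_free E" "lpa_free E Quot lpa_ideal E"
      "lpa_class E :: _ \<Rightarrow> (('v, 'e) lpa_gen, 'k) ncpoly set"
    by (rule lpa_class_hom)
  have "\<zero>\<^bsub>lpa_free E\<^esub> = (0 :: (('v, 'e) lpa_gen, 'k) ncpoly)"
    by (simp add: lpa_free_def free_algebra_simps)
  with hom_zero show ?thesis
    by (simp add: leavitt_def Let_def)
qed

lemma leavitt_cases [consumes 1]:
  assumes "a \<in> carrier (leavitt E)"
  obtains f where "f \<in> carrier (lpa_free E)" "Poly_Mapping.lookup f 0 = 0" "a = lpa_class E f"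
  using assms by (auto simp: leavitt_def Let_def)

lemma lpa_class_in_leavitt:
  "\<lbrakk>f \<in> carrier (lpa_free E); Poly_Mapping.lookup f 0 = 0\<rbrakk> \<Longrightarrow> lpa_class E f \<in> carrier (leavitt E)"
  by (auto simp: leavitt_def Let_def)

text \<open>The laws pass from polynomials to their classes. Sums, negatives and products keep the
  constant term 0, so the operations stay inside the smaller carrier.\<close>

lemma nonunital_ring_leavitt: "nonunital_ring (leavitt E)"
proof -
  note [simp] = lpa_class_mult lpa_class_add lpa_class_zero lookup_add zero_in_free_algebra[of "lpa_gens E", folded lpa_free_def]
    free_algebra_closed[where S = "lpa_gens E", folded lpa_free_def]
    uminus_in_free_algebra[where S = "lpa_gens E", folded lpa_free_def]
    lpa_class_in_leavitt lookup_mult_0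
  have "abelian_group (leavitt E)"
  proof (rule abelian_groupI, goal_cases)
    case (1 a b) then show ?case by (elim leavitt_cases) simp
  next
    case 2 show ?case by simp
  next
    case (3 a b d) then show ?case by (elim leavitt_cases) (simp add: add.assoc)
  next
    case (4 a b) then show ?case by (elim leavitt_cases) (simp add: add.commute)
  next
    case (5 a) then show ?case by (elim leavitt_cases) simp
  next
    case (6 a)
    then obtain f where f: "f \<in> carrier (lpa_free E)" "Poly_Mapping.lookup f 0 = 0" "a = lpa_class E f"
      by (rule leavitt_cases)
    then have "lpa_class E (- f) \<in> carrier (leavitt E)" by simp
    moreover from f have "lpa_class E (- f) \<oplus>\<^bsub>leavitt E\<^esub> a = \<zero>\<^bsub>leavitt E\<^esub>" by simp
    ultimately show ?case by blast
  qed
  show ?thesis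
  proof (intro nonunital_ring.intro nonunital_ring_axioms.intro, goal_cases)
    case 1 show ?case by fact
  next
    case (2 a b) then show ?case by (elim leavitt_cases) simp
  next
    case (3 a b d) then show ?case by (elim leavitt_cases) (simp add: mult.assoc)
  next
    case (4 a b d) then show ?case by (elim leavitt_cases) (simp add: distrib_right)
  next
    case (5 a b d) then show ?case by (elim leavitt_cases) (simp add: distrib_left)
  qed
qed

end

section \<open>Exclusive cycles\<close>

locale exclusive_cycle_digraph = wf_digraph E
  for E :: "('v, 'e) pre_digraph" +
  fixes c :: "'e list"
  assumes exclusive: "exclusive_cycle E c"
begin

abbreviation base :: 'v where "base \<equiv> cycle_base E c"
abbreviation cverts :: "'v set" where "cverts \<equiv> cycle_verts E c"

lemma awalk_cycle: "awalk base c base"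
  and distinct_tails: "distinct (map (tail E) c)"
  and cycle_nonempty: "c \<noteq> []"
proof -
  have "cycle c"
    using exclusive unfolding exclusive_cycle_def by (rule conjunct1)
  then obtain u where u: "awalk u c u" "distinct (tl (awalk_verts u c))" and ne: "c \<noteq> []"
    unfolding cycle_def by blast
  have verts: "awalk_verts u c = map (tail E) c @ [head E (last c)]"
    by (simp add: awalk_verts_conv ne)
  have u_tail: "tail E (hd c) = u"
    using u(1) ne by (cases c) (simp_all add: awalk_Cons_iff)
  then show "awalk base c base"
    using u(1) by (simp add: cycle_base_def)
  have "awlast u c = u"
    using u(1) unfolding awalk_conv by blast
  \<comment> \<open>The walk closes up, so its last vertex is the tail of the first arc. The
    vertices after the first are thus the tails of \<open>c\<close>, rotated by one place.\<close>
  then have "distinct (tl (map (tail E) c) @ [tail E (hd c)])"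
    using u(2) ne by (simp add: verts u_tail)
  then show "distinct (map (tail E) c)"
    using ne by (cases c) auto
  show "c \<noteq> []" by fact
qed

section \<open>Arcs and reachability around an exclusive cycle\<close>

lemma arcs_cycle: "set c \<subseteq> arcs E"
  using awalk_cycle by auto

lemma tail_in_cverts: "e \<in> set c \<Longrightarrow> tail E e \<in> cverts"
  by (simp add: cycle_verts_def)

lemma cverts_cases:
  assumes "u \<in> cverts"
  obtains e where "e \<in> set c" "tail E e = u"
  using assms by (auto simp: cycle_verts_def)

lemma cverts_subset_verts: "cverts \<subseteq> verts E"
  using arcs_cycle by (auto simp: cycle_verts_def)

lemma base_in_cverts: "base \<in> cverts"
  using cycle_nonempty by (simp add: cycle_base_def cycle_verts_def)

lemma cycle_arc_eqI: "\<lbrakk>e \<in> set c; f \<in> set c; tail E e = tail E f\<rbrakk> \<Longrightarrow> e = f"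
  using distinct_tails by (auto simp: distinct_map inj_on_def)

text \<open>What follows \<open>e\<close> in \<open>c\<close> is a walk from \<open>head E e\<close>
  to \<open>base\<close>: either it is empty and the head is \<open>base\<close>, or its first arc
  lies on \<open>c\<close> and starts at the head.\<close>

lemma head_in_cverts:
  assumes "e \<in> set c"
  shows "head E e \<in> cverts"
proof -
  obtain xs ys where c: "c = xs @ e # ys"
    using assms by (meson split_list)
  then have "awalk (head E e) ys base"
    using awalk_cycle by (auto simp: awalk_append_iff awalk_Cons_iff)
  then show ?thesis
    using base_in_cverts by (cases ys) (auto simp: c awalk_Cons_iff awalk_Nil_iff cycle_verts_def)
qed

text \<open>Both vertices lie on the closed walk \<open>c\<close>, so \<open>x\<close> reaches
  \<open>base\<close> and \<open>base\<close> reaches \<open>y\<close>.\<close>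

lemma cverts_strongly_connected:
  assumes "x \<in> cverts" "y \<in> cverts"
  shows "x \<rightarrow>\<^sup>*\<^bsub>E\<^esub> y"
proof -
  have *: "cverts \<subseteq> set (awalk_verts base c)"
    by (auto simp: awalk_verts_conv cycle_verts_def)
  have "x \<rightarrow>\<^sup>*\<^bsub>E\<^esub> base" "base \<rightarrow>\<^sup>*\<^bsub>E\<^esub> y"
    using assms * awalk_verts_reachable_to[OF awalk_cycle] awalk_verts_reachable_from[OF awalk_cycle]
    by blast+
  then show ?thesis
    by (rule reachable_trans)
qed

text \<open>Closing the arc by a simple path from its head back to its tail gives a cycle based at a
  vertex of \<^term>\<open>c\<close>.\<close>

lemma arc_in_cycle:
  assumes e: "e \<in> arcs E" "tail E e \<in> cverts" and y: "head E e \<rightarrow>\<^sup>*\<^bsub>E\<^esub> y" "y \<in> cverts"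
  shows "e \<in> set c"
proof -
  have "head E e \<rightarrow>\<^sup>*\<^bsub>E\<^esub> tail E e"
    using y(1) cverts_strongly_connected[OF y(2) e(2)] by (rule reachable_trans)
  then obtain p where p: "apath (head E e) p (tail E e)"
    by (auto simp: reachable_apath)
  then have "cycle (e # p)"
    using e(1) by (auto simp: cycle_def apath_def awalk_Cons_iff)
  moreover obtain i where "i < length c" "tail E (c ! i) = tail E e"
    using e(2) by (auto simp: cycle_verts_def in_set_conv_nth)
  ultimately have "e # p = rotate i c"
    using exclusive unfolding exclusive_cycle_def cycle_base_def by (metis list.sel(1))
  then show ?thesis
    by (metis list.set_intros(1) set_rotate)
qed

lemma in_tree_iff: "x \<in> tree E u \<longleftrightarrow> u \<rightarrow>\<^sup>*\<^bsub>E\<^esub> x"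
  by (simp add: tree_def reachable_awalk)

lemma cverts_subset_tree: "cverts \<subseteq> tree E base"
  using cverts_strongly_connected[OF base_in_cverts] by (auto simp: in_tree_iff)

text \<open>Induction along a walk from \<open>base\<close> to \<open>x\<close>: it cannot leave
  \<open>c\<close>, because by \<open>arc_in_cycle\<close> an arc from \<open>c\<close> whose head
  can still reach \<open>c\<close> belongs to \<open>c\<close>.\<close>

lemma tree_returning_in_cverts:
  assumes "x \<in> tree E base" "x \<rightarrow>\<^sup>*\<^bsub>E\<^esub> y" "y \<in> cverts"
  shows "x \<in> cverts"
proof -
  have "base \<rightarrow>\<^sup>*\<^bsub>E\<^esub> x"
    using assms(1) by (simp add: in_tree_iff)
  then show ?thesis
    using assms(2)
  proof (induction rule: reachable_induct)
    case base
    then show ?case by (simp add: base_in_cverts)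
  next
    case (step x z)
    then obtain e where e: "e \<in> arcs E" "tail E e = x" "head E e = z"
      by (auto simp: arcs_ends_def arc_to_ends_def)
    \<comment> \<open>The predecessor reaches \<open>y\<close> through its successor, so the
      induction hypothesis applies to it.\<close>
    have "x \<in> cverts"
      using step by (meson reachable_adj_trans adj_reachable_trans)
    then have "e \<in> set c"
      using e step.prems by (intro arc_in_cycle[OF e(1) _ _ assms(3)]) auto
    then show ?case
      using head_in_cverts e(3) by blast
  qed
qed

lemma exit_arc_head: "\<lbrakk>e \<in> arcs E; tail E e \<in> cverts; e \<notin> set c\<rbrakk> \<Longrightarrow> head E e \<notin> cverts"
  using arc_in_cycle cverts_strongly_connected by blast

lemma arc_head_in_tree:
  assumes "e \<in> arcs E" "tail E e \<in> tree E base"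
  shows "head E e \<in> tree E base"
  using assms reachable_trans[OF _ reachable_adjI] by (auto simp: in_tree_iff intro: in_arcs_imp_in_arcs_ends)

subsection \<open>The paths of \<open>Fplus\<close>\<close>

abbreviation F :: "('v, 'e) path set" where "F \<equiv> Fplus E c"

lemma Nil_in_Fplus_iff [simp]: "(u, []) \<in> F \<longleftrightarrow> u \<in> cverts"
  by (simp add: Fplus_def)

text \<open>A recursive description of \<open>F\<close>: the condition on the head of the first of
  several arcs is the source condition of the remaining path, and a single arc leaves a trivial path
  at a vertex of \<open>c\<close>.\<close>

lemma Cons_in_Fplus_iff:
  "(u, f # fs) \<in> F \<longleftrightarrow>
    f \<in> arcs E \<and> tail E f = u \<and> u \<notin> tree E base \<and> (head E f, fs) \<in> F"
proof (cases fs)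
  case Nil
  then show ?thesis
    using cverts_subset_verts by (auto simp: Fplus_def awalk_Cons_iff awalk_Nil_iff)
next
  case (Cons g gs)
  then show ?thesis
    by (auto simp: Fplus_def awalk_Cons_iff)
qed

lemma Fplus_source_in_tree:
  assumes "(u, fs) \<in> F" "u \<in> tree E base"
  shows "fs = []" "u \<in> cverts"
  using assms by (cases fs; simp add: Cons_in_Fplus_iff)+

lemma Fplus_source_in_cverts: "\<lbrakk>(u, fs) \<in> F; u \<in> cverts\<rbrakk> \<Longrightarrow> fs = []"
  using Fplus_source_in_tree(1) cverts_subset_tree by blast

lemma Fplus_source_in_verts: "(u, fs) \<in> F \<Longrightarrow> u \<in> verts E"
  using cverts_subset_verts by (cases fs) (auto simp: Cons_in_Fplus_iff)

text \<open>If the tail of \<open>e\<close> were in the tree, so would be its head. A path of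
  \<open>F\<close> starting there forces the head onto \<open>c\<close>, so the tail leads back to
  \<open>c\<close> and would itself lie on \<open>c\<close>.\<close>

lemma Cons_in_Fplus_iff_head:
  assumes "e \<in> arcs E" "tail E e \<notin> cverts"
  shows "(tail E e, e # fs) \<in> F \<longleftrightarrow> (head E e, fs) \<in> F"
proof -
  have "tail E e \<notin> tree E base" if F: "(head E e, fs) \<in> F"
  proof
    assume tree: "tail E e \<in> tree E base"
    then have "head E e \<in> cverts"
      using F Fplus_source_in_tree arc_head_in_tree assms(1) by blast
    moreover have "tail E e \<rightarrow>\<^sup>*\<^bsub>E\<^esub> head E e"
      using assms(1) by (intro reachable_adjI in_arcs_imp_in_arcs_ends)
    ultimately show False
      using tree tree_returning_in_cverts assms(2) by blast
  qed
  then show ?thesis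
    using assms(1) by (auto simp: Cons_in_Fplus_iff)
qed

end

section \<open>Sequences of finite support\<close>

text \<open>The index set is \<open>{1, 2, \<dots>}\<close>, so position 0 carries the junk value 0.\<close>

definition fin_seq :: "(nat \<Rightarrow> 'k::field) \<Rightarrow> bool" where
  "fin_seq q \<longleftrightarrow> finite {i. q i \<noteq> 0} \<and> q 0 = 0"

text \<open>The Neumann series of \<open>1 + shift\<close>, that is, the sum of the powers of minus
  the shift. The form agrees with the sum in \<open>op_ghost\<close>.\<close>

definition alt_sum :: "(nat \<Rightarrow> 'k::field) \<Rightarrow> nat \<Rightarrow> 'k" where
  "alt_sum q i = (\<Sum>j | i \<le> j \<and> q j \<noteq> 0. (-1) ^ (j - i) * q j)"

lemma fin_seq_bounded:
  assumes "fin_seq q"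
  obtains N where "\<And>i. N \<le> i \<Longrightarrow> q i = 0"
proof -
  from assms obtain N where "\<And>i. q i \<noteq> 0 \<Longrightarrow> i < N"
    unfolding fin_seq_def finite_nat_set_iff_bounded by auto
  then show thesis
    by (intro that[of N]) (meson leD)
qed

lemma fin_seqI: "\<lbrakk>\<And>i. N \<le> i \<Longrightarrow> q i = 0; q 0 = 0\<rbrakk> \<Longrightarrow> fin_seq q"
  unfolding fin_seq_def finite_nat_set_iff_bounded by (auto intro!: exI[of _ N] leI)

lemma fin_seq_zero [simp]: "fin_seq 0"
  by (simp add: fin_seq_def)

lemma fin_seq_add: "\<lbrakk>fin_seq p; fin_seq q\<rbrakk> \<Longrightarrow> fin_seq (p + q)"
  unfolding fin_seq_def by (auto intro: finite_subset[of _ "{i. p i \<noteq> 0} \<union> {i. q i \<noteq> 0}"])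

lemma fin_seq_scale: "fin_seq q \<Longrightarrow> fin_seq (\<lambda>i. k * q i)"
  unfolding fin_seq_def by (auto elim: finite_subset[rotated])

lemma alt_sum_bounded:
  assumes "\<And>i. N \<le> i \<Longrightarrow> q i = 0"
  shows "alt_sum q i = (\<Sum>j=i..<N. (-1) ^ (j - i) * q j)"
  unfolding alt_sum_def
  by (rule sum.mono_neutral_left) (use assms in \<open>auto simp: not_le[symmetric]\<close>)

lemma alt_sum_eq_0:
  assumes "\<And>i. N \<le> i \<Longrightarrow> q i = 0" "N \<le> i"
  shows "alt_sum q i = 0"
  using assms(2) by (simp add: alt_sum_bounded[OF assms(1)])

lemma alt_sum_add:
  assumes "fin_seq p" "fin_seq q"
  shows "alt_sum (p + q) i = alt_sum p i + alt_sum q i"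
proof -
  obtain M N where M: "\<And>i. M \<le> i \<Longrightarrow> p i = 0" and N: "\<And>i. N \<le> i \<Longrightarrow> q i = 0"
    using fin_seq_bounded[OF assms(1)] fin_seq_bounded[OF assms(2)] by metis
  have "alt_sum r i = (\<Sum>j=i..<max M N. (-1) ^ (j - i) * r j)" if "r \<in> {p, q, p + q}" for r
    using that M N by (intro alt_sum_bounded) auto
  then show ?thesis
    by (simp add: distrib_left sum.distrib)
qed

text \<open>The summation set depends on the support: it is unchanged for
  \<open>k \<noteq> 0\<close> and becomes empty for \<open>k = 0\<close>, whence the case
  split.\<close>

lemma alt_sum_scale: "alt_sum (\<lambda>i. k * q i) i = k * alt_sum q i"
  by (cases "k = 0") (auto simp: alt_sum_def sum_distrib_left mult.left_commute)

text \<open>The term \<open>j = i\<close> is split off; in the others the exponent drops by one,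
  which changes the sign. This says that \<open>1 + shift\<close> after \<open>alt_sum\<close> is
  the identity.\<close>

lemma alt_sum_Suc:
  assumes "fin_seq q"
  shows "alt_sum q i = q i - alt_sum q (Suc i)"
proof -
  obtain N where N: "\<And>i. N \<le> i \<Longrightarrow> q i = 0"
    using fin_seq_bounded[OF assms] by metis
  let ?N = "max N (Suc i)"
  have "alt_sum q i = q i + (\<Sum>j=Suc i..<?N. (-1) ^ (j - i) * q j)"
    using N by (subst alt_sum_bounded[of ?N]) (auto simp: sum.atLeast_Suc_lessThan)
  also have "(\<Sum>j=Suc i..<?N. (-1) ^ (j - i) * q j) = - (\<Sum>j=Suc i..<?N. (-1) ^ (j - Suc i) * q j)"
    unfolding sum_negf[symmetric]
  proof (rule sum.cong[OF refl])
    fix j assume "j \<in> {Suc i..<?N}"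
    then have "j - i = Suc (j - Suc i)" by auto
    then show "(-1) ^ (j - i) * q j = - ((-1) ^ (j - Suc i) * q j)" by simp
  qed
  also have "(\<Sum>j=Suc i..<?N. (-1) ^ (j - Suc i) * q j) = alt_sum q (Suc i)"
    using N by (subst alt_sum_bounded[of ?N]) auto
  finally show ?thesis by simp
qed

text \<open>The other one-sided inverse, by descending induction from a bound of the support. Index
  \<open>Suc i\<close> avoids position 0, where the shifted sequence is set to 0.\<close>

lemma alt_sum_shift_add:
  assumes "fin_seq q"
  shows "alt_sum (\<lambda>i. if 1 \<le> i then q (i + 1) + q i else 0) (Suc i) = q (Suc i)"
proof -
  let ?s = "\<lambda>i. if 1 \<le> i then q (i + 1) + q i else 0"
  obtain N where N: "\<And>i. N \<le> i \<Longrightarrow> q i = 0"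
    using fin_seq_bounded[OF assms] by metis
  have s: "fin_seq ?s"
    by (rule fin_seqI[of N]) (use N in auto)
  \<comment> \<open>\<open>k\<close> is the distance from \<open>i\<close> up to the bound
    \<open>N\<close>; at \<open>k = 0\<close> both sides vanish.\<close>
  have "alt_sum ?s (Suc i) = q (Suc i)" if "i + k = N" for k
    using that
  proof (induction k arbitrary: i)
    case 0
    then have "alt_sum ?s (Suc i) = 0"
      using N by (intro alt_sum_eq_0[of N]) auto
    then show ?case
      using N[of "Suc i"] 0 by simp
  next
    case (Suc k)
    then show ?case
      using alt_sum_Suc[OF s, of "Suc i"] by simp
  qed
  moreover have "alt_sum ?s (Suc i) = q (Suc i)" if "N \<le> i"
    using that N alt_sum_eq_0[of N ?s "Suc i"] by simp
  ultimately show ?thesis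
    by (metis le_add_diff_inverse nat_le_linear)
qed

section \<open>The operators\<close>

definition series_scale :: "'k::field \<Rightarrow> ('v, 'e, 'k) series \<Rightarrow> ('v, 'e, 'k) series" where
  "series_scale k p = (\<lambda>\<mu> i. k * p \<mu> i)"

lemma vector_space_series_scale: "vector_space series_scale"
  by unfold_locales (auto simp: series_scale_def fun_eq_iff algebra_simps)

fun gen_op :: "('v, 'e) pre_digraph \<Rightarrow> 'e list \<Rightarrow> ('v, 'e) lpa_gen
    \<Rightarrow> ('v, 'e, 'k::field) series \<Rightarrow> ('v, 'e, 'k) series" where
  "gen_op E c (Vertex u) = op_vertex E c u"
| "gen_op E c (Edge e) = op_edge E c e"
| "gen_op E c (Ghost e) = op_ghost E c e"

context exclusive_cycle_digraph
begin

section \<open>Series spaces and transport of coefficients along cycle arcs\<close>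

abbreviation space :: "('v, 'e, 'k::field) series set" where
  "space \<equiv> carrier (series_space E c)"

abbreviation space_sf :: "('v, 'e, 'k::field) series set" where
  "space_sf \<equiv> carrier (series_space_sf E c)"

lemma in_space_iff: "p \<in> space \<longleftrightarrow> (\<forall>\<mu>. fin_seq (p \<mu>)) \<and> (\<forall>\<mu>. \<mu> \<notin> F \<longrightarrow> p \<mu> = 0)"
  by (auto simp: series_space_def fin_seq_def fun_eq_iff)

lemma in_space_sf_iff: "p \<in> space_sf \<longleftrightarrow> p \<in> space \<and> finite (fst ` {\<mu>. p \<mu> \<noteq> 0})"
proof -
  have "{fst \<mu> | \<mu>. \<exists>i. p \<mu> i \<noteq> 0} = fst ` {\<mu>. p \<mu> \<noteq> 0}"
    unfolding image_Collect by (auto simp: fun_eq_iff)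
  then show ?thesis
    by (simp add: series_space_sf_def)
qed

lemma space_fin_seq: "p \<in> space \<Longrightarrow> fin_seq (p \<mu>)"
  and space_at_0: "p \<in> space \<Longrightarrow> p \<mu> 0 = 0"
  and space_outside: "\<lbrakk>p \<in> space; \<mu> \<notin> F\<rbrakk> \<Longrightarrow> p \<mu> = 0"
  unfolding in_space_iff fin_seq_def by blast+

text \<open>The effect of a cycle arc on a coefficient sequence: \<open>1 + shift\<close> if it
  enters \<open>base\<close>, the identity otherwise. Position 0 is reset to keep
  \<open>fin_seq\<close>.\<close>

definition twist :: "'e \<Rightarrow> (nat \<Rightarrow> 'k::field) \<Rightarrow> nat \<Rightarrow> 'k" where
  "twist e q = (if head E e = base then (\<lambda>i. if 1 \<le> i then q (i + 1) + q i else 0) else q)"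

definition untwist :: "'e \<Rightarrow> (nat \<Rightarrow> 'k::field) \<Rightarrow> nat \<Rightarrow> 'k" where
  "untwist e q = (if head E e = base then (\<lambda>i. if 1 \<le> i then alt_sum q i else 0) else q)"

lemma fin_seq_twist: "fin_seq q \<Longrightarrow> fin_seq (twist e q)"
proof -
  assume q: "fin_seq q"
  then obtain N where "\<And>i. N \<le> i \<Longrightarrow> q i = 0"
    using fin_seq_bounded by metis
  then show ?thesis
    using q by (intro fin_seqI[of N]) (auto simp: twist_def fin_seq_def)
qed

lemma fin_seq_untwist: "fin_seq q \<Longrightarrow> fin_seq (untwist e q)"
proof -
  assume q: "fin_seq q"
  then obtain N where N: "\<And>i. N \<le> i \<Longrightarrow> q i = 0"
    using fin_seq_bounded by metis
  then show ?thesis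
    using q by (intro fin_seqI[of N]) (auto simp: untwist_def fin_seq_def alt_sum_eq_0[OF N])
qed

lemma twist_add: "twist e (p + q) = twist e p + twist e q"
  by (auto simp: twist_def fun_eq_iff)

lemma twist_scale: "twist e (\<lambda>i. k * q i) = (\<lambda>i. k * twist e q i)"
  by (auto simp: twist_def fun_eq_iff distrib_left)

lemma untwist_add: "\<lbrakk>fin_seq p; fin_seq q\<rbrakk> \<Longrightarrow> untwist e (p + q) = untwist e p + untwist e q"
  by (auto simp: untwist_def fun_eq_iff alt_sum_add)

lemma untwist_scale: "untwist e (\<lambda>i. k * q i) = (\<lambda>i. k * untwist e q i)"
  by (auto simp: untwist_def fun_eq_iff alt_sum_scale)

lemma untwist_zero [simp]: "untwist e 0 = 0"
  by (auto simp: untwist_def fun_eq_iff alt_sum_def)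

lemma untwist_twist: "fin_seq q \<Longrightarrow> untwist e (twist e q) = q"
proof
  fix i assume "fin_seq q"
  then show "untwist e (twist e q) i = q i"
    by (cases i) (auto simp: untwist_def twist_def alt_sum_shift_add[simplified] fin_seq_def)
qed

lemma twist_untwist: "fin_seq q \<Longrightarrow> twist e (untwist e q) = q"
proof
  fix i assume "fin_seq q"
  then show "twist e (untwist e q) i = q i"
    using alt_sum_Suc[of q i] by (cases i) (auto simp: untwist_def twist_def fin_seq_def)
qed

section \<open>Pointwise formulas for the operators\<close>

lemma on_domain_apply:
  assumes "g \<mu> 0 = 0" "\<mu> \<notin> F \<Longrightarrow> g \<mu> = 0"
  shows "on_domain E c g \<mu> = g \<mu>"
proof
  fix i
  show "on_domain E c g \<mu> i = g \<mu> i"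
    using assms by (cases "i = 0") (auto simp: on_domain_def)
qed

lemma op_vertex_apply:
  assumes "p \<in> space"
  shows "op_vertex E c u p \<mu> = (if fst \<mu> = u then p \<mu> else 0)"
  unfolding op_vertex_def
  by (subst on_domain_apply) (simp_all add: space_at_0[OF assms] space_outside[OF assms] fun_eq_iff)

text \<open>No truncation by the domain occurs: by \<open>Cons_in_Fplus_iff_head\<close> the path
  stays in \<open>F\<close> on prepending \<open>e\<close> exactly if it was there before, and
  \<open>p\<close> is 0 elsewhere.\<close>

lemma op_edge_outer:
  assumes p: "p \<in> space" and e: "e \<in> arcs E" "tail E e \<notin> cverts"
  shows "op_edge E c e p (u, []) = 0"
    "op_edge E c e p (u, f # fs) = (if f = e \<and> u = tail E e then p (head E e, fs) else 0)"
proof -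
  show "op_edge E c e p (u, []) = 0"
    using e(2) by (simp add: op_edge_def on_domain_def fun_eq_iff)
  have "op_edge E c e p (u, f # fs) i =
      (if f = e \<and> u = tail E e then p (head E e, fs) i else 0)" for i
  proof (cases "f = e \<and> u = tail E e")
    case True
    show ?thesis
    proof (cases "(head E e, fs) \<in> F \<and> 1 \<le> i")
      case inner: True
      then show ?thesis
        using True e(2) Cons_in_Fplus_iff_head[OF e, of fs] by (simp add: op_edge_def on_domain_def)
    next
      case False
      then have "p (head E e, fs) i = 0"
        using space_at_0[OF p] space_outside[OF p] by (cases "i = 0") simp_all
      then show ?thesis
        using True e(2) by (simp add: op_edge_def on_domain_def)
    qed
  next
    case False
    then have "f = e \<Longrightarrow> (u, f # fs) \<notin> F"
      by (simp add: Cons_in_Fplus_iff)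
    then have "op_edge E c e p (u, f # fs) i = 0"
      using e(2) by (simp add: op_edge_def on_domain_def)
    then show ?thesis
      by (simp only: False if_False)
  qed
  then show "op_edge E c e p (u, f # fs) =
      (if f = e \<and> u = tail E e then p (head E e, fs) else 0)"
    by (intro ext) simp
qed

lemma op_ghost_outer:
  assumes p: "p \<in> space" and e: "e \<in> arcs E" "tail E e \<notin> cverts"
  shows "op_ghost E c e p (u, fs) = (if u = head E e then p (tail E e, e # fs) else 0)"
proof -
  have "(tail E e, e # fs) \<notin> F" if "(head E e, fs) \<notin> F"
    using that Cons_in_Fplus_iff_head[OF e] by simp
  then show ?thesis
    unfolding op_ghost_def using e(2)
    by (subst on_domain_apply) (auto simp: space_at_0[OF p] space_outside[OF p] intro!: ext)
qed

text \<open>The head of an arc of \<open>c\<close> is again on \<open>c\<close>, so only the two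
  branches covered by \<open>twist\<close> occur.\<close>

lemma op_edge_cycle:
  assumes p: "p \<in> space" and e: "e \<in> set c"
  shows "op_edge E c e p (u, fs) = (if u = tail E e \<and> fs = [] then twist e (p (head E e, [])) else 0)"
proof
  fix i
  show "op_edge E c e p (u, fs) i =
      (if u = tail E e \<and> fs = [] then twist e (p (head E e, [])) else 0) i"
    using tail_in_cverts[OF e] head_in_cverts[OF e] space_at_0[OF p]
    by (cases "i = 0") (simp_all add: op_edge_def on_domain_def twist_def)
qed

lemma op_ghost_cycle:
  assumes p: "p \<in> space" and e: "e \<in> set c"
  shows "op_ghost E c e p (u, fs) = (if u = head E e \<and> fs = [] then untwist e (p (tail E e, [])) else 0)"
proof
  fix i
  show "op_ghost E c e p (u, fs) i =
      (if u = head E e \<and> fs = [] then untwist e (p (tail E e, [])) else 0) i"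
    using tail_in_cverts[OF e] head_in_cverts[OF e] space_at_0[OF p]
    by (cases "i = 0") (simp_all add: op_ghost_def on_domain_def untwist_def alt_sum_def)
qed

lemma op_edge_exit:
  assumes "e \<in> arcs E" "tail E e \<in> cverts" "e \<notin> set c"
  shows "op_edge E c e p \<mu> = 0"
proof -
  have "head E e \<noteq> base"
    using exit_arc_head[OF assms] base_in_cverts by metis
  then show ?thesis
    using exit_arc_head[OF assms] assms(2) by (simp add: op_edge_def on_domain_def fun_eq_iff)
qed

text \<open>The image could live only on the trivial path at \<open>head E e\<close>, which is
  outside \<open>F\<close> because this head is off \<open>c\<close>.\<close>

lemma op_ghost_exit:
  assumes "e \<in> arcs E" "tail E e \<in> cverts" "e \<notin> set c"
  shows "op_ghost E c e p \<mu> = 0"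
  using exit_arc_head[OF assms] assms(2) by (simp add: op_ghost_def on_domain_def fun_eq_iff)

lemma arc_cases:
  assumes "e \<in> arcs E"
  obtains (outer) "tail E e \<notin> cverts" | (cyc) "e \<in> set c" | (exit) "tail E e \<in> cverts" "e \<notin> set c"
  by blast

end

lemma sum_fun_apply: "(\<Sum>a\<in>A. f a) x = (\<Sum>a\<in>A. f a x :: 'b::comm_monoid_add)"
  by (induction A rule: infinite_finite_induct) simp_all

context exclusive_cycle_digraph
begin

section \<open>Invariance of the series spaces and linearity of the operators\<close>

lemma gen_op_outside: "\<mu> \<notin> F \<Longrightarrow> gen_op E c x p \<mu> = 0"
  by (cases x) (auto simp: op_vertex_def op_edge_def op_ghost_def on_domain_def fun_eq_iff)

lemma gen_op_fin_seq:
  assumes "x \<in> lpa_gens E" "p \<in> space"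
  shows "fin_seq (gen_op E c x p \<mu>)"
proof -
  note fin = space_fin_seq[OF assms(2)]
  obtain u fs where \<mu>: "\<mu> = (u, fs)" by (cases \<mu>)
  consider (vertex) u where "x = Vertex u" | (edge) e where "x = Edge e" "e \<in> arcs E"
    | (ghost) e where "x = Ghost e" "e \<in> arcs E"
    using assms(1) by (auto simp: lpa_gens_def)
  then show ?thesis
  proof cases
    case vertex
    then show ?thesis
      using fin assms(2) by (simp add: op_vertex_apply)
  next
    case edge
    from edge(2) show ?thesis
      by (cases e rule: arc_cases; cases fs)
        (use edge assms(2) fin in \<open>simp_all add: \<mu> op_edge_outer op_edge_cycle op_edge_exit fin_seq_twist\<close>)
  next
    case ghost
    from ghost(2) show ?thesis
      by (cases e rule: arc_cases)
        (use ghost assms(2) fin in \<open>simp_all add: \<mu> op_ghost_outer op_ghost_cycle op_ghost_exit fin_seq_untwist\<close>)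
  qed
qed

lemma gen_op_closed: "\<lbrakk>x \<in> lpa_gens E; p \<in> space\<rbrakk> \<Longrightarrow> gen_op E c x p \<in> space"
  using gen_op_fin_seq gen_op_outside unfolding in_space_iff[of "gen_op E c x p"] by blast

lemma space_add: "\<lbrakk>p \<in> space; q \<in> space\<rbrakk> \<Longrightarrow> p + q \<in> space"
  unfolding in_space_iff by (simp add: fin_seq_add)

lemma space_scale: "p \<in> space \<Longrightarrow> series_scale k p \<in> space"
  unfolding in_space_iff series_scale_def by (simp add: fin_seq_scale fun_eq_iff)

lemma space_zero: "0 \<in> space"
  by (simp add: in_space_iff)

lemma gen_op_add:
  assumes "x \<in> lpa_gens E" "p \<in> space" "q \<in> space"
  shows "gen_op E c x (p + q) = gen_op E c x p + gen_op E c x q"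
proof
  fix \<mu> :: "('v, 'e) path"
  note pq = assms(2,3) space_add[OF assms(2,3)] space_fin_seq[OF assms(2)] space_fin_seq[OF assms(3)]
  obtain u fs where \<mu>: "\<mu> = (u, fs)" by (cases \<mu>)
  consider (vertex) u where "x = Vertex u" | (edge) e where "x = Edge e" "e \<in> arcs E"
    | (ghost) e where "x = Ghost e" "e \<in> arcs E"
    using assms(1) by (auto simp: lpa_gens_def)
  then show "gen_op E c x (p + q) \<mu> = (gen_op E c x p + gen_op E c x q) \<mu>"
  proof cases
    case vertex
    then show ?thesis
      using pq by (simp add: op_vertex_apply)
  next
    case edge
    from edge(2) show ?thesis
      by (cases e rule: arc_cases; cases fs)
        (use edge pq in \<open>simp_all add: \<mu> op_edge_outer op_edge_cycle op_edge_exit twist_add\<close>)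
  next
    case ghost
    from ghost(2) show ?thesis
      by (cases e rule: arc_cases)
        (use ghost pq in \<open>simp_all add: \<mu> op_ghost_outer op_ghost_cycle op_ghost_exit untwist_add\<close>)
  qed
qed

lemma gen_op_scale:
  assumes "x \<in> lpa_gens E" "p \<in> space"
  shows "gen_op E c x (series_scale k p) = series_scale k (gen_op E c x p)"
proof
  fix \<mu> :: "('v, 'e) path"
  note p = assms(2) space_scale[OF assms(2), of k]
  have scale: "series_scale k q \<nu> = (\<lambda>i. k * q \<nu> i)" for q :: "('v, 'e, 'k::field) series" and k \<nu>
    by (simp add: series_scale_def)
  \<comment> \<open>Simplifying \<open>k * 0\<close> under the abstraction leaves a constant
    function, which has to be folded back into \<open>0\<close>.\<close>
  note zero = zero_fun_def[symmetric]
  obtain u fs where \<mu>: "\<mu> = (u, fs)" by (cases \<mu>)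
  consider (vertex) u where "x = Vertex u" | (edge) e where "x = Edge e" "e \<in> arcs E"
    | (ghost) e where "x = Ghost e" "e \<in> arcs E"
    using assms(1) by (auto simp: lpa_gens_def)
  then show "gen_op E c x (series_scale k p) \<mu> = series_scale k (gen_op E c x p) \<mu>"
  proof cases
    case vertex
    then show ?thesis
      using p by (simp add: op_vertex_apply scale zero)
  next
    case edge
    from edge(2) show ?thesis
      by (cases e rule: arc_cases; cases fs)
        (use edge p in \<open>simp_all add: \<mu> op_edge_outer op_edge_cycle op_edge_exit twist_scale scale zero\<close>)
  next
    case ghost
    from ghost(2) show ?thesis
      by (cases e rule: arc_cases)
        (use ghost p in \<open>simp_all add: \<mu> op_ghost_outer op_ghost_cycle op_ghost_exit untwist_scale scale zero\<close>)
  qed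
qed

lemma op_in_space [simp]:
  assumes "p \<in> space"
  shows "u \<in> verts E \<Longrightarrow> op_vertex E c u p \<in> space"
    "e \<in> arcs E \<Longrightarrow> op_edge E c e p \<in> space"
    "e \<in> arcs E \<Longrightarrow> op_ghost E c e p \<in> space"
  using assms gen_op_closed[of "Vertex u" p] gen_op_closed[of "Edge e" p] gen_op_closed[of "Ghost e" p]
  by (simp_all add: lpa_gens_def)

text \<open>The single source is the vertex itself, the tail of an edge or the head of a ghost edge.
  This yields source finiteness of the image.\<close>

lemma sources_gen_op_subset:
  assumes "x \<in> lpa_gens E" "p \<in> space"
  obtains u where "fst ` {\<mu>. gen_op E c x p \<mu> \<noteq> 0} \<subseteq> {u}"
proof -
  consider (vertex) u where "x = Vertex u" | (edge) e where "x = Edge e" "e \<in> arcs E"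
    | (ghost) e where "x = Ghost e" "e \<in> arcs E"
    using assms(1) by (auto simp: lpa_gens_def)
  then show thesis
  proof cases
    case vertex
    then have "gen_op E c x p \<mu> = 0" if "fst \<mu> \<noteq> u" for \<mu>
      using that assms(2) by (simp add: op_vertex_apply)
    then show ?thesis
      by (intro that[of u]) blast
  next
    case edge
    from edge(2) have "gen_op E c x p (u, fs) = 0" if "u \<noteq> tail E e" for u fs
      by (cases e rule: arc_cases; cases fs)
        (use that edge assms(2) in \<open>simp_all add: op_edge_outer op_edge_cycle op_edge_exit\<close>)
    then show ?thesis
      by (intro that[of "tail E e"]) force
  next
    case ghost
    from ghost(2) have "gen_op E c x p (u, fs) = 0" if "u \<noteq> head E e" for u fs
      by (cases e rule: arc_cases)
        (use that ghost assms(2) in \<open>simp_all add: op_ghost_outer op_ghost_cycle op_ghost_exit\<close>)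
    then show ?thesis
      by (intro that[of "head E e"]) force
  qed
qed

lemma gen_op_closed_sf:
  assumes "x \<in> lpa_gens E" "p \<in> space_sf"
  shows "gen_op E c x p \<in> space_sf"
proof -
  have p: "p \<in> space"
    using assms(2) in_space_sf_iff by blast
  obtain u where "fst ` {\<mu>. gen_op E c x p \<mu> \<noteq> 0} \<subseteq> {u}"
    using sources_gen_op_subset[OF assms(1) p] .
  then have "finite (fst ` {\<mu>. gen_op E c x p \<mu> \<noteq> 0})"
    by (rule finite_subset) simp
  then show ?thesis
    using gen_op_closed[OF assms(1) p] in_space_sf_iff by blast
qed

subsection \<open>The defining relations\<close>

lemma op_vertex_vertex:
  assumes "p \<in> space" "u \<in> verts E" "w \<in> verts E"
  shows "op_vertex E c u (op_vertex E c w p) = (if u = w then op_vertex E c u p else 0)"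
  by (rule ext) (use assms in \<open>simp add: op_vertex_apply\<close>)

lemma op_tail_edge:
  assumes "p \<in> space" "e \<in> arcs E"
  shows "op_vertex E c (tail E e) (op_edge E c e p) = op_edge E c e p"
proof (rule ext, clarify)
  fix u fs
  from assms(2) show "op_vertex E c (tail E e) (op_edge E c e p) (u, fs) = op_edge E c e p (u, fs)"
    by (cases e rule: arc_cases; cases fs)
      (use assms in \<open>simp_all add: op_vertex_apply op_edge_outer op_edge_cycle op_edge_exit\<close>)
qed

lemma op_edge_head:
  assumes "p \<in> space" "e \<in> arcs E"
  shows "op_edge E c e (op_vertex E c (head E e) p) = op_edge E c e p"
proof (rule ext, clarify)
  fix u fs
  from assms(2) show "op_edge E c e (op_vertex E c (head E e) p) (u, fs) = op_edge E c e p (u, fs)"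
    by (cases e rule: arc_cases; cases fs)
      (use assms in \<open>simp_all add: op_vertex_apply op_edge_outer op_edge_cycle op_edge_exit\<close>)
qed

lemma op_head_ghost:
  assumes "p \<in> space" "e \<in> arcs E"
  shows "op_vertex E c (head E e) (op_ghost E c e p) = op_ghost E c e p"
proof (rule ext, clarify)
  fix u fs
  from assms(2) show "op_vertex E c (head E e) (op_ghost E c e p) (u, fs) = op_ghost E c e p (u, fs)"
    by (cases e rule: arc_cases)
      (use assms in \<open>simp_all add: op_vertex_apply op_ghost_outer op_ghost_cycle op_ghost_exit\<close>)
qed

lemma op_ghost_tail:
  assumes "p \<in> space" "e \<in> arcs E"
  shows "op_ghost E c e (op_vertex E c (tail E e) p) = op_ghost E c e p"
proof (rule ext, clarify)
  fix u fs
  from assms(2) show "op_ghost E c e (op_vertex E c (tail E e) p) (u, fs) = op_ghost E c e p (u, fs)"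
    by (cases e rule: arc_cases)
      (use assms in \<open>simp_all add: op_vertex_apply op_ghost_outer op_ghost_cycle op_ghost_exit\<close>)
qed

lemma space_source_in_cverts:
  "\<lbrakk>p \<in> space; u \<in> cverts; fs \<noteq> []\<rbrakk> \<Longrightarrow> p (u, fs) = 0"
  using Fplus_source_in_cverts space_outside by blast

text \<open>The head of an arc leaving \<open>c\<close> is in the tree but off \<open>c\<close>, and
  no path of \<open>F\<close> starts at such a vertex. Hence the projection onto this head is 0,
  matching the zero operators of the arc.\<close>

lemma space_exit_head:
  assumes "p \<in> space" "e \<in> arcs E" "tail E e \<in> cverts" "e \<notin> set c"
  shows "p (head E e, fs) = 0"
proof (rule space_outside[OF assms(1)])
  have "head E e \<in> tree E base"
    using assms(2,3) cverts_subset_tree arc_head_in_tree by blast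
  then show "(head E e, fs) \<notin> F"
    using Fplus_source_in_tree(2) exit_arc_head[OF assms(2-4)] by blast
qed

text \<open>For \<open>e = f\<close>, prepending and deleting \<open>e\<close> cancel off
  \<open>c\<close>, \<open>untwist\<close> inverts \<open>twist\<close> on \<open>c\<close>, and for
  arcs leaving \<open>c\<close> both sides vanish. For distinct arcs, either one operator is 0 or
  the ghost edge reads coefficients where the edge has written 0.\<close>

lemma op_ghost_edge:
  assumes p: "p \<in> space" and ef: "e \<in> arcs E" "f \<in> arcs E"
  shows "op_ghost E c e (op_edge E c f p) = (if e = f then op_vertex E c (head E e) p else 0)"
proof (rule ext, clarify)
  fix u fs
  have *: "op_edge E c f p \<in> space"
    using p ef by simp
  from ef(1) show "op_ghost E c e (op_edge E c f p) (u, fs) =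
      (if e = f then op_vertex E c (head E e) p else 0) (u, fs)"
  proof (cases e rule: arc_cases)
    case outer
    from ef(2) show ?thesis
    proof (cases f rule: arc_cases)
      case f: outer
      then show ?thesis
        using outer p ef * by (cases "e = f") (simp_all add: op_ghost_outer op_edge_outer op_vertex_apply)
    next
      case cyc
      then have "e \<noteq> f"
        using outer tail_in_cverts by metis
      then show ?thesis
        using outer cyc p ef(1) * by (simp add: op_ghost_outer op_edge_cycle)
    next
      case exit
      then have "e \<noteq> f"
        using outer by metis
      then show ?thesis
        using outer exit ef * by (simp add: op_ghost_outer op_edge_exit)
    qed
  next
    case cyc
    from ef(2) show ?thesis
    proof (cases f rule: arc_cases)
      case outer
      then have "e \<noteq> f"
        using cyc tail_in_cverts by metis
      then show ?thesis
        using outer cyc p ef(2) * by (simp add: op_ghost_cycle op_edge_outer)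
    next
      case f: cyc
      show ?thesis
      proof (cases "e = f")
        case True
        then show ?thesis
          using cyc p * space_source_in_cverts[OF p head_in_cverts[OF cyc], of fs] space_fin_seq[OF p]
          by (cases "fs = []") (simp_all add: op_ghost_cycle op_edge_cycle op_vertex_apply untwist_twist)
      next
        case False
        then have "tail E e \<noteq> tail E f"
          using cycle_arc_eqI[OF cyc f] by metis
        with False show ?thesis
          using cyc f p * by (simp add: op_ghost_cycle op_edge_cycle)
      qed
    next
      case exit
      then have "e \<noteq> f"
        using cyc by metis
      then show ?thesis
        using cyc exit ef * by (simp add: op_ghost_cycle op_edge_exit)
    qed
  next
    case exit
    then show ?thesis
      using p ef space_exit_head[OF p ef(1) exit, of fs]
      by (cases "e = f") (simp_all add: op_ghost_exit op_vertex_apply)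
  qed
qed

text \<open>Off \<open>c\<close> the composite is the projection onto the paths with first arc
  \<open>e\<close>.\<close>

lemma op_edge_ghost_outer:
  assumes p: "p \<in> space" and e: "e \<in> arcs E" "tail E e \<notin> cverts"
  shows "op_edge E c e (op_ghost E c e p) (u, []) = 0"
    "op_edge E c e (op_ghost E c e p) (u, f # fs) = (if f = e \<and> u = tail E e then p (u, f # fs) else 0)"
  using p e by (simp_all add: op_edge_outer op_ghost_outer)

text \<open>The trivial path is the only path of \<open>F\<close> with source
  \<open>tail E e\<close>, and there \<open>twist\<close> inverts \<open>untwist\<close>: one arc
  already gives the whole vertex projection.\<close>

lemma op_edge_ghost_cycle:
  assumes p: "p \<in> space" and e: "e \<in> set c"
  shows "op_edge E c e (op_ghost E c e p) = op_vertex E c (tail E e) p"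
proof (rule ext, clarify)
  fix u fs
  have "e \<in> arcs E"
    using e arcs_cycle by blast
  moreover have "p (tail E e, fs) = 0" if "fs \<noteq> []"
    using space_source_in_cverts[OF p tail_in_cverts[OF e] that] .
  ultimately show "op_edge E c e (op_ghost E c e p) (u, fs) = op_vertex E c (tail E e) p (u, fs)"
    using p e space_fin_seq[OF p]
    by (auto simp: op_edge_cycle op_ghost_cycle op_vertex_apply twist_untwist)
qed

text \<open>At a vertex of \<open>c\<close> the unique cycle arc contributes everything and the
  others act as 0. At any other vertex \<open>u\<close>, the paths of \<open>F\<close> starting at
  \<open>u\<close> are nontrivial and are sorted by their first arc.\<close>

lemma op_vertex_eq_sum:
  assumes p: "p \<in> space" and out: "finite (out_arcs E u)" "out_arcs E u \<noteq> {}"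
  shows "op_vertex E c u p = (\<Sum>e\<in>out_arcs E u. op_edge E c e (op_ghost E c e p))"
proof (cases "u \<in> cverts")
  case True
  then obtain d where d: "d \<in> set c" "tail E d = u"
    by (rule cverts_cases)
  have "op_edge E c e (op_ghost E c e p) = 0" if "e \<in> out_arcs E u - {d}" for e
  proof (rule ext)
    fix \<mu>
    have "e \<notin> set c"
      using that d cycle_arc_eqI by auto
    then show "op_edge E c e (op_ghost E c e p) \<mu> = 0 \<mu>"
      using that True by (simp add: op_edge_exit)
  qed
  moreover have "d \<in> out_arcs E u"
    using d arcs_cycle by auto
  ultimately have "(\<Sum>e\<in>out_arcs E u. op_edge E c e (op_ghost E c e p)) = op_edge E c d (op_ghost E c d p)"
    using out(1) by (simp add: sum.remove)
  then show ?thesis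
    using op_edge_ghost_cycle[OF p d(1)] d(2) by simp
next
  case False
  show ?thesis
  proof (rule ext, clarify)
    fix w fs
    have "(\<Sum>e\<in>out_arcs E u. op_edge E c e (op_ghost E c e p)) (w, fs) =
        (\<Sum>e\<in>out_arcs E u. op_edge E c e (op_ghost E c e p) (w, fs))"
      by (rule sum_fun_apply)
    also have "\<dots> = (if w = u then p (w, fs) else 0)"
    proof (cases fs)
      case Nil
      have "p (u, []) = 0"
        using False by (intro space_outside[OF p]) simp
      then show ?thesis
        using False p Nil by (simp add: op_edge_ghost_outer)
    next
      case (Cons f gs)
      \<comment> \<open>If \<open>u\<close> does not emit \<open>f\<close>, no summand survives; the
        coefficient must then be 0 as well.\<close>
      have "p (u, fs) = 0" if "f \<notin> out_arcs E u"
        using that Cons by (intro space_outside[OF p]) (auto simp: Cons_in_Fplus_iff)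
      moreover have "(\<Sum>e\<in>out_arcs E u. op_edge E c e (op_ghost E c e p) (w, fs)) =
          (\<Sum>e\<in>out_arcs E u. if e = f then (if w = u then p (w, fs) else 0) else 0)"
        using False p Cons by (intro sum.cong) (auto simp: op_edge_ghost_outer)
      ultimately show ?thesis
        using out(1) by auto
    qed
    finally show "op_vertex E c u p (w, fs) =
        (\<Sum>e\<in>out_arcs E u. op_edge E c e (op_ghost E c e p)) (w, fs)"
      using p by (simp add: op_vertex_apply)
  qed
qed

end

section \<open>The module structure\<close>

lemma (in free_algebra_rep) poly_act_gen_mult_gen:
  "\<lbrakk>x \<in> S; y \<in> S; v \<in> V\<rbrakk> \<Longrightarrow> poly_act (gen x * gen y) v = \<phi> x (\<phi> y v)"
  by (simp add: poly_act_mult gen_in_free_algebra)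

section \<open>Subspaces as algebraic structures, and the premodule over the Leavitt path
  algebra\<close>

context vector_space
begin

lemma abelian_group_subspace:
  fixes M (structure)
  assumes "subspace (carrier M)" "\<And>x y. x \<oplus> y = x + y" "\<zero> = 0"
  shows "abelian_group M"
proof (rule abelian_groupI, unfold assms(2,3), goal_cases)
  case (6 x)
  then show ?case
    using subspace_neg[OF assms(1)] by (intro bexI[of _ "- x"]) simp_all
qed (simp_all add: subspace_add[OF assms(1)] subspace_0[OF assms(1)] add.assoc add.commute)

lemma module_subspace:
  fixes M (structure)
  assumes "subspace (carrier M)" "\<And>x y. x \<oplus> y = x + y" "\<zero> = 0" "\<And>k x. k \<odot> x = scale k x"
  shows "Module.module ring_of_type_algebra M"
  by (rule moduleI)
    (auto simp: assms(2-) ring_of_type_algebra_def subspace_scale[OF assms(1)]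
      scale_left_distrib scale_right_distrib intro: abelian_group_subspace assms(1-3)
      cring_from_type_algebra[unfolded ring_of_type_algebra_def])

end

context leavitt_rep
begin

lemma quotient_act_class:
  "\<lbrakk>f \<in> carrier (lpa_free E); v \<in> V\<rbrakk> \<Longrightarrow> quotient_act (lpa_class E f) v = poly_act f v"
  unfolding lpa_class_def lpa_ideal_def lpa_free_def by (rule quotient_act_coset)

text \<open>Every ring element is the class of a polynomial, so the axioms reduce to those of
  \<open>poly_act\<close>. Keeping \<open>M\<close> abstract lets the lemma serve both series
  spaces.\<close>

lemma left_premodule_quotient_act:
  fixes M (structure)
  assumes M: "carrier M = V" "\<And>x y. x \<oplus>\<^bsub>M\<^esub> y = x + y" "\<zero>\<^bsub>M\<^esub> = 0"
  shows "left_premodule (leavitt E) M quotient_act"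
proof (intro left_premodule.intro left_premodule_axioms.intro, goal_cases)
  case 1
  show ?case by (rule nonunital_ring_leavitt) unfold_locales
next
  case 2
  show ?case by (rule abelian_group_subspace) (simp_all add: M subspace_V)
next
  case (3 a x)
  then show ?case
    by (elim leavitt_cases[OF wf_digraph_axioms])
      (simp add: M quotient_act_class poly_act_closed[folded lpa_free_def])
next
  case (4 a b x)
  then show ?case
    by (elim leavitt_cases[OF wf_digraph_axioms])
      (simp add: M quotient_act_class lpa_class_add[OF wf_digraph_axioms]
        free_algebra_closed[where S = "lpa_gens E", folded lpa_free_def] poly_act_add)
next
  case (5 a x y)
  then show ?case
    by (elim leavitt_cases[OF wf_digraph_axioms])
      (simp add: M quotient_act_class subspace_add[OF subspace_V]
        poly_act_add_right[folded lpa_free_def])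
next
  case (6 a b x)
  then show ?case
    by (elim leavitt_cases[OF wf_digraph_axioms])
      (simp add: M quotient_act_class lpa_class_mult[OF wf_digraph_axioms]
        free_algebra_closed[where S = "lpa_gens E", folded lpa_free_def]
        poly_act_mult[folded lpa_free_def] poly_act_closed[folded lpa_free_def])
qed

text \<open>Multiplication by \<open>k\<close> is multiplication by the constant
  \<open>scalar k\<close>, which acts as \<open>scale k\<close>. The computation is made in the
  unital free algebra, where \<open>scalar k\<close> is available.\<close>

lemma quotient_act_smult_left:
  assumes "a \<in> carrier (leavitt E)" "v \<in> V"
  shows "quotient_act (k \<odot>\<^bsub>leavitt E\<^esub> a) v = scale k (quotient_act a v)"
proof -
  obtain f where f: "f \<in> carrier (lpa_free E)" "a = lpa_class E f"
    using assms(1) by (rule leavitt_cases[OF wf_digraph_axioms])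
  have k: "scalar k \<in> carrier (lpa_free E)"
    by (simp add: lpa_free_def scalar_in_free_algebra)
  show ?thesis
    using f k assms(2) free_algebra_closed(3)[of "scalar k" "lpa_gens E" f]
    by (simp add: lpa_class_smult[OF wf_digraph_axioms] quotient_act_class lpa_free_def poly_act_mult)
qed

lemma quotient_act_smult_right:
  assumes "a \<in> carrier (leavitt E)" "v \<in> V"
  shows "quotient_act a (scale k v) = scale k (quotient_act a v)"
proof -
  obtain f where f: "f \<in> carrier (lpa_free E)" "a = lpa_class E f"
    using assms(1) by (rule leavitt_cases[OF wf_digraph_axioms])
  then show ?thesis
    using assms(2) subspace_scale[OF subspace_V]
    by (simp add: quotient_act_class poly_act_scale_right[folded lpa_free_def])
qed

lemma gen_in_lpa_free: "x \<in> lpa_gens E \<Longrightarrow> gen x \<in> carrier (lpa_free E)"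
  by (simp add: lpa_free_def gen_in_free_algebra)

lemma quotient_act_gen:
  "\<lbrakk>x \<in> lpa_gens E; v \<in> V\<rbrakk> \<Longrightarrow> quotient_act (lpa_class E (gen x)) v = \<phi> x v"
  by (simp add: quotient_act_class gen_in_lpa_free)

lemma gen_class_in_leavitt: "x \<in> lpa_gens E \<Longrightarrow> lpa_class E (gen x) \<in> carrier (leavitt E)"
  by (rule lpa_class_in_leavitt[OF wf_digraph_axioms gen_in_lpa_free])
    (simp_all add: gen_def lookup_single zero_fmonoid_def)

end

lemma finsum_eq_sum:
  fixes M (structure)
  assumes "abelian_group M" "\<And>x y. x \<oplus> y = x + y" "\<zero> = (0 :: 'b::comm_monoid_add)"
    and "finite A" "\<And>a. a \<in> A \<Longrightarrow> f a \<in> carrier M"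
  shows "(\<Oplus>a\<in>A. f a) = (\<Sum>a\<in>A. f a)"
proof -
  interpret abelian_group M by fact
  show ?thesis
    using assms(4,5) by (induction A rule: finite_induct) (auto simp: assms(2,3))
qed

section \<open>The two series spaces as representations\<close>

context exclusive_cycle_digraph
begin

lemma subspace_space: "module.subspace series_scale space"
proof -
  interpret vector_space series_scale by (rule vector_space_series_scale)
  show ?thesis
    by (rule subspaceI) (simp_all add: space_zero space_add space_scale)
qed

lemma subspace_space_sf: "module.subspace series_scale space_sf"
proof -
  interpret vector_space series_scale by (rule vector_space_series_scale)
  show ?thesis
  proof (rule subspaceI)
    show "0 \<in> space_sf"
      using space_zero by (simp add: in_space_sf_iff)
  next
    fix p q :: "('v, 'e, 'k::field) series"
    assume "p \<in> space_sf" "q \<in> space_sf"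
    then have fin: "finite (fst ` {\<mu>. p \<mu> \<noteq> 0} \<union> fst ` {\<mu>. q \<mu> \<noteq> 0})"
      and "p + q \<in> space"
      by (simp_all add: in_space_sf_iff space_add)
    moreover have "{\<mu>. (p + q) \<mu> \<noteq> 0} \<subseteq> {\<mu>. p \<mu> \<noteq> 0} \<union> {\<mu>. q \<mu> \<noteq> 0}"
      by auto
    then have "fst ` {\<mu>. (p + q) \<mu> \<noteq> 0} \<subseteq> fst ` {\<mu>. p \<mu> \<noteq> 0} \<union> fst ` {\<mu>. q \<mu> \<noteq> 0}"
      unfolding image_Un[symmetric] by (rule image_mono)
    ultimately show "p + q \<in> space_sf"
      unfolding in_space_sf_iff using finite_subset by blast
  next
    fix k and p :: "('v, 'e, 'k::field) series"
    assume p: "p \<in> space_sf"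
    have "{\<mu>. series_scale k p \<mu> \<noteq> 0} \<subseteq> {\<mu>. p \<mu> \<noteq> 0}"
      by (auto simp: series_scale_def fun_eq_iff)
    then have "fst ` {\<mu>. series_scale k p \<mu> \<noteq> 0} \<subseteq> fst ` {\<mu>. p \<mu> \<noteq> 0}"
      by (rule image_mono)
    with p show "series_scale k p \<in> space_sf"
      unfolding in_space_sf_iff using finite_subset space_scale by blast
  qed
qed

lemma free_algebra_rep_space: "free_algebra_rep series_scale space (lpa_gens E) (gen_op E c)"
  by (intro free_algebra_rep.intro free_algebra_rep_axioms.intro vector_space_series_scale
      subspace_space gen_op_closed gen_op_add gen_op_scale)

lemma space_sf_subset: "space_sf \<subseteq> space"
  using in_space_sf_iff by blast

lemma free_algebra_rep_space_sf: "free_algebra_rep series_scale space_sf (lpa_gens E) (gen_op E c)"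
  by (intro free_algebra_rep.intro free_algebra_rep_axioms.intro vector_space_series_scale
      subspace_space_sf gen_op_closed_sf gen_op_add gen_op_scale; use space_sf_subset in blast)

text \<open>Collects the operator identities, one for each family of relations. Stated on the larger
  space, it yields the relations on both spaces.\<close>

lemma lpa_relation_acts_as_zero:
  assumes "r \<in> lpa_relations E" "p \<in> space"
  shows "free_algebra_rep.poly_act series_scale (gen_op E c) r p = 0"
proof -
  interpret free_algebra_rep series_scale space "lpa_gens E" "gen_op E c"
    by (rule free_algebra_rep_space)
  have gens [simp]: "\<And>u. u \<in> verts E \<Longrightarrow> Vertex u \<in> lpa_gens E"
    "\<And>e. e \<in> arcs E \<Longrightarrow> Edge e \<in> lpa_gens E" "\<And>e. e \<in> arcs E \<Longrightarrow> Ghost e \<in> lpa_gens E"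
    by (simp_all add: lpa_gens_def)
  note [simp] = poly_act_diff poly_act_gen_mult_gen assms(2)
  from assms(1) consider
      (vertices) u w where "u \<in> verts E" "w \<in> verts E"
        "r = gen (Vertex u) * gen (Vertex w) - (if u = w then gen (Vertex u) else 0)"
    | (tail_edge) e where "e \<in> arcs E" "r = gen (Vertex (tail E e)) * gen (Edge e) - gen (Edge e)"
    | (edge_head) e where "e \<in> arcs E" "r = gen (Edge e) * gen (Vertex (head E e)) - gen (Edge e)"
    | (head_ghost) e where "e \<in> arcs E" "r = gen (Vertex (head E e)) * gen (Ghost e) - gen (Ghost e)"
    | (ghost_tail) e where "e \<in> arcs E" "r = gen (Ghost e) * gen (Vertex (tail E e)) - gen (Ghost e)"
    | (ghost_edge) e f where "e \<in> arcs E" "f \<in> arcs E"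
        "r = gen (Ghost e) * gen (Edge f) - (if e = f then gen (Vertex (head E e)) else 0)"
    | (vertex_sum) u where "u \<in> verts E" "finite (out_arcs E u)" "out_arcs E u \<noteq> {}"
        "r = gen (Vertex u) - (\<Sum>e\<in>out_arcs E u. gen (Edge e) * gen (Ghost e))"
    unfolding lpa_relations_def by blast
  then show ?thesis
  proof cases
    case vertices
    then show ?thesis by (cases "u = w") (simp_all add: op_vertex_vertex)
  next
    case tail_edge
    then show ?thesis by (simp add: op_tail_edge)
  next
    case edge_head
    then show ?thesis by (simp add: op_edge_head)
  next
    case head_ghost
    then show ?thesis by (simp add: op_head_ghost)
  next
    case ghost_tail
    then show ?thesis by (simp add: op_ghost_tail)
  next
    case ghost_edge
    then show ?thesis by (cases "e = f") (simp_all add: op_ghost_edge)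
  next
    case vertex_sum
    have "poly_act (\<Sum>e\<in>out_arcs E u. gen (Edge e) * gen (Ghost e)) p =
        (\<Sum>e\<in>out_arcs E u. op_edge E c e (op_ghost E c e p))"
      unfolding poly_act_sum by (rule sum.cong) simp_all
    with vertex_sum show ?thesis
      by (simp add: op_vertex_eq_sum)
  qed
qed

lemma leavitt_rep_space: "leavitt_rep E series_scale space (gen_op E c)"
proof -
  interpret free_algebra_rep series_scale space "lpa_gens E" "gen_op E c"
    by (rule free_algebra_rep_space)
  show ?thesis
    by unfold_locales
      (use lpa_relations_subset[OF wf_digraph_axioms] lpa_relation_acts_as_zero
        in \<open>auto simp: annihilator_def lpa_free_def\<close>)
qed

lemma leavitt_rep_space_sf: "leavitt_rep E series_scale space_sf (gen_op E c)"
proof -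
  interpret free_algebra_rep series_scale space_sf "lpa_gens E" "gen_op E c"
    by (rule free_algebra_rep_space_sf)
  show ?thesis
    by unfold_locales
      (use lpa_relations_subset[OF wf_digraph_axioms] lpa_relation_acts_as_zero space_sf_subset
        in \<open>auto simp: annihilator_def lpa_free_def\<close>)
qed

lemma series_space_ops:
  "x \<oplus>\<^bsub>series_space E c\<^esub> y = x + y" "\<zero>\<^bsub>series_space E c\<^esub> = 0"
  "k \<odot>\<^bsub>series_space E c\<^esub> x = series_scale k x"
  "x \<oplus>\<^bsub>series_space_sf E c\<^esub> y = x + y" "\<zero>\<^bsub>series_space_sf E c\<^esub> = 0"
  "k \<odot>\<^bsub>series_space_sf E c\<^esub> x = series_scale k x"
  by (simp_all add: series_space_def series_space_sf_def series_scale_def fun_eq_iff)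

text \<open>Each vertex projects onto the paths with that source, so a series is recovered from the
  sources in its support, a finite set here.\<close>

lemma series_sf_eq_sum_op_vertex:
  assumes p: "p \<in> space_sf"
  defines "U \<equiv> fst ` {\<mu>. p \<mu> \<noteq> 0}"
  shows "finite U" "U \<subseteq> verts E" "p = (\<Sum>u\<in>U. op_vertex E c u p)"
proof -
  have sp: "p \<in> space"
    using p space_sf_subset by blast
  show fin: "finite U"
    using p in_space_sf_iff unfolding U_def by blast
  show "U \<subseteq> verts E"
  proof
    fix u assume "u \<in> U"
    then obtain fs where "p (u, fs) \<noteq> 0"
      by (auto simp: U_def)
    then show "u \<in> verts E"
      using space_outside[OF sp] Fplus_source_in_verts by blast
  qed
  show "p = (\<Sum>u\<in>U. op_vertex E c u p)"
  proof
    fix \<mu>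
    have "(\<Sum>u\<in>U. op_vertex E c u p) \<mu> = (if fst \<mu> \<in> U then p \<mu> else 0)"
      using fin sp by (simp add: sum_fun_apply op_vertex_apply)
    moreover have "p \<mu> = 0" if "fst \<mu> \<notin> U"
      using that by (auto simp: U_def)
    ultimately show "p \<mu> = (\<Sum>u\<in>U. op_vertex E c u p) \<mu>"
      by simp
  qed
qed

end

theorem proposition4p19:
  fixes E :: "('v, 'e) pre_digraph" and c :: "'e list"
  assumes "wf_digraph E" and "exclusive_cycle E c"
  shows "module (ring_of_type_algebra :: 'k::field ring)
           (series_space E c :: ('k, ('v, 'e, 'k) series) module)
    \<and> submodule (carrier (series_space_sf E c :: ('k, ('v, 'e, 'k) series) module))
           (ring_of_type_algebra :: 'k ring)
           (series_space E c :: ('k, ('v, 'e, 'k) series) module)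
    \<and> (\<exists>act. left_premodule (leavitt E) (series_space E c :: ('k, ('v, 'e, 'k) series) module) act
           \<and> bilinear_action (leavitt E) (series_space E c) act
           \<and> extends_operators E c act
           \<and> left_module (leavitt E) (series_space_sf E c) act)"
proof -
  interpret exclusive_cycle_digraph E c
    by (intro exclusive_cycle_digraph.intro exclusive_cycle_digraph_axioms.intro assms)
  interpret vec: vector_space "series_scale :: 'k \<Rightarrow> ('v, 'e, 'k) series \<Rightarrow> _"
    by (rule vector_space_series_scale)
  interpret full: leavitt_rep E "series_scale :: 'k \<Rightarrow> ('v, 'e, 'k) series \<Rightarrow> _" space "gen_op E c"
    by (rule leavitt_rep_space)
  interpret sf: leavitt_rep E "series_scale :: 'k \<Rightarrow> ('v, 'e, 'k) series \<Rightarrow> _" space_sf "gen_op E c"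
    by (rule leavitt_rep_space_sf)
  let ?K = "ring_of_type_algebra :: 'k ring"
  let ?M = "series_space E c :: ('k, ('v, 'e, 'k) series) module"
  let ?N = "series_space_sf E c :: ('k, ('v, 'e, 'k) series) module"
  have mod: "module ?K ?M" "module ?K ?N"
    by (rule vec.module_subspace; simp add: series_space_ops subspace_space subspace_space_sf)+
  have sub: "submodule (carrier ?N) ?K ?M"
  proof (rule module.module_incl_imp_submodule[OF mod(1) space_sf_subset])
    have "?M\<lparr>carrier := carrier ?N\<rparr> = ?N"
      by (simp add: series_space_sf_def)
    then show "module ?K (?M\<lparr>carrier := carrier ?N\<rparr>)"
      using mod(2) by simp
  qed
  have pre: "left_premodule (leavitt E) ?M full.quotient_act"
    by (rule full.left_premodule_quotient_act) (simp_all add: series_space_ops)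
  have bil: "bilinear_action (leavitt E) ?M full.quotient_act"
    unfolding bilinear_action_def series_space_ops
    using full.quotient_act_smult_left full.quotient_act_smult_right by blast
  have ext: "extends_operators E c (full.quotient_act :: _ \<Rightarrow> ('v, 'e, 'k) series \<Rightarrow> _)"
    unfolding extends_operators_def using full.quotient_act_gen by (simp add: lpa_gens_def)
  \<comment> \<open>\<open>quotient_act\<close> does not depend on the chosen subspace, so
    \<open>full.quotient_act\<close> and \<open>sf.quotient_act\<close> coincide and facts about
    either apply.\<close>
  have pre_sf: "left_premodule (leavitt E) ?N full.quotient_act"
    by (rule sf.left_premodule_quotient_act) (simp_all add: series_space_ops)
  have "left_module (leavitt E) ?N full.quotient_act"
  proof (intro left_module.intro left_module_axioms.intro pre_sf)
    fix x assume x: "x \<in> carrier ?N"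
    define U where "U = fst ` {\<mu>. x \<mu> \<noteq> 0}"
    note U = series_sf_eq_sum_op_vertex[OF x, folded U_def]
    \<comment> \<open>Unitarity asks for a sum indexed by an initial segment of the naturals, so
      \<open>U\<close> is enumerated.\<close>
    obtain h where h: "bij_betw h {..<card U} U"
      using ex_bij_betw_nat_finite[OF U(1)] by (auto simp: atLeast0LessThan)
    let ?a = "\<lambda>i. lpa_class E (gen (Vertex (h i))) :: (('v, 'e) lpa_gen, 'k) ncpoly set"
    have gens: "Vertex (h i) \<in> lpa_gens E" if "i < card U" for i
      using that U(2) bij_betwE[OF h] by (auto simp: lpa_gens_def)
    then have a: "?a i \<in> carrier (leavitt E)" if "i < card U" for i
      using that full.gen_class_in_leavitt by blast
    have "(\<Oplus>\<^bsub>?N\<^esub>i\<in>{..<card U}. full.quotient_act (?a i) x) =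
        (\<Sum>i<card U. full.quotient_act (?a i) x)"
    proof (rule finsum_eq_sum)
      show "abelian_group ?N"
        using mod(2) by (simp add: Module.module_def)
    qed (use a x left_premodule.act_closed[OF pre_sf] in \<open>simp_all add: series_space_ops\<close>)
    also have "\<dots> = (\<Sum>i<card U. op_vertex E c (h i) x)"
    proof (rule sum.cong[OF refl])
      fix i assume "i \<in> {..<card U}"
      then show "full.quotient_act (?a i) x = op_vertex E c (h i) x"
        using sf.quotient_act_gen[OF gens x] by simp
    qed
    also have "\<dots> = (\<Sum>u\<in>U. op_vertex E c u x)"
      by (rule sum.reindex_bij_betw[OF h])
    finally have "x = (\<Oplus>\<^bsub>?N\<^esub>i\<in>{..<card U}. full.quotient_act (?a i) x)"
      using U(3) by simp
    then show "\<exists>(n::nat) a y. (\<forall>i<n. a i \<in> carrier (leavitt E) \<and> y i \<in> carrier ?N) \<and>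
        x = (\<Oplus>\<^bsub>?N\<^esub>i\<in>{..<n}. full.quotient_act (a i) (y i))"
      \<comment> \<open>The vertices in \<open>U\<close> act as local units: the ring elements are
        their classes and every module element is \<open>x\<close> itself.\<close>
      using a x by (intro exI[of _ "card U"] exI[of _ ?a] exI[of _ "\<lambda>_. x"]) simp
  qed
  with mod(1) sub pre bil ext show ?thesis
    by blast
qed

end
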